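(* Let $r>0$ and let $g$ be a $C^4$ Riemannian metric on the ball $B(O,r)\subseteq\mathbb{R}^2$, with coordinates $(x,y)$, whose Gauss curvature $k$ satisfies $k>0$ in $B(O,r)\setminus\{O\}$. Suppose that $X:(B(O,r),g)\to(\mathbb{R}^3,g_{can})$ is a $C^{1,1}$ isometric embedding of the form $$X:(x,y)\longmapsto (x,y,u(x,y)),$$ where $u(0,0)=0$ and $u_x(0,0)=u_y(0,0)=0$. Then $X\in C^{2,1}(B(O,r))$.
   Context: $B(O,r)$ is the open ball in $\mathbb{R}^2$ of radius $r$ centred at the origin $O=(0,0)$, and $g_{can}$ is the standard flat metric on $\mathbb{R}^3$. The coordinates $x,y$ on the ball are those in which $g$ is $C^4$. Isometric means $X^*g_{can}=g$, i.e. here $g=dx^2+dy^2+du^2=(1+u_x^2)\,dx^2+2u_xu_y\,dx\,dy+(1+u_y^2)\,dy^2$. $C^{k,1}$ denotes functions (or maps) with derivatives up to order $k$ which are Lipschitz; on an open set $\Omega$, membership in $C^{k,1}(\Omega)$ is understood locally, i.e. the $k$-th order derivatives are Lipschitz on compact subsets of $\Omega$. *)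

theory Defs
  imports "HOL-Analysis.Analysis"
begin

definition partial :: "'n::finite \<Rightarrow> (real^'n \<Rightarrow> 'b::real_normed_vector) \<Rightarrow> real^'n \<Rightarrow> 'b"
  where "partial i f p = frechet_derivative f (at p) (axis i 1)"

text \<open>
  The class \<open>C\<^sup>k(S)\<close> and the class \<open>C\<^sup>k\<^sup>,\<^sup>1(S)\<close>, to be used with open \<open>S\<close> only. Membership in the
  latter is local: the derivatives of order \<open>k\<close> are Lipschitz on compact subsets of \<open>S\<close>.
\<close>

fun Ck_on :: "nat \<Rightarrow> (real^'n::finite \<Rightarrow> 'b::real_normed_vector) \<Rightarrow> (real^'n) set \<Rightarrow> bool" where
  "Ck_on 0 f S \<longleftrightarrow> continuous_on S f"
| "Ck_on (Suc k) f S \<longleftrightarrow>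
    (\<forall>p\<in>S. f differentiable (at p)) \<and> (\<forall>i. Ck_on k (partial i f) S)"

fun Ck1_on :: "nat \<Rightarrow> (real^'n::finite \<Rightarrow> 'b::real_normed_vector) \<Rightarrow> (real^'n) set \<Rightarrow> bool" where
  "Ck1_on 0 f S \<longleftrightarrow> (\<forall>K. compact K \<and> K \<subseteq> S \<longrightarrow> (\<exists>L. L-lipschitz_on K f))"
| "Ck1_on (Suc k) f S \<longleftrightarrow>
    (\<forall>p\<in>S. f differentiable (at p)) \<and> (\<forall>i. Ck1_on k (partial i f) S)"

text \<open>
  A metric is represented by its Gram matrix in the standard coordinates:
  \<open>g p $ i $ j = g\<^sub>p(\<partial>\<^sub>i, \<partial>\<^sub>j)\<close>.
\<close>

definition Ck_riemannian_metric_on :: "nat \<Rightarrow> (real^'n::finite \<Rightarrow> real^'n^'n) \<Rightarrow> (real^'n) set \<Rightarrow> bool"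
  where "Ck_riemannian_metric_on k g S \<longleftrightarrow>
    Ck_on k g S \<and>
    (\<forall>p\<in>S. transpose (g p) = g p \<and> (\<forall>v. v \<noteq> 0 \<longrightarrow> v \<bullet> (g p *v v) > 0))"

definition christoffel :: "(real^'n::finite \<Rightarrow> real^'n^'n) \<Rightarrow> 'n \<Rightarrow> 'n \<Rightarrow> 'n \<Rightarrow> real^'n \<Rightarrow> real"
  where "christoffel g k i j p =
    (1/2) * (\<Sum>l\<in>UNIV. matrix_inv (g p) $ k $ l *
      (partial i (\<lambda>q. g q $ j $ l) p + partial j (\<lambda>q. g q $ i $ l) p
        - partial l (\<lambda>q. g q $ i $ j) p))"

text \<open>
  \<open>riemann g l k i j\<close> is the component along \<open>\<partial>\<^sub>l\<close> of \<open>R(\<partial>\<^sub>i, \<partial>\<^sub>j) \<partial>\<^sub>k\<close>, where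
  \<open>R(X, Y) = \<nabla>\<^sub>X \<nabla>\<^sub>Y - \<nabla>\<^sub>Y \<nabla>\<^sub>X - \<nabla>\<^bsub>[X,Y]\<^esub>\<close>. With this sign convention the Gauss curvature below,
  \<open>g(R(\<partial>\<^sub>1, \<partial>\<^sub>2) \<partial>\<^sub>2, \<partial>\<^sub>1) / det g\<close>, is positive for the round sphere.
\<close>

definition riemann ::
    "(real^'n::finite \<Rightarrow> real^'n^'n) \<Rightarrow> 'n \<Rightarrow> 'n \<Rightarrow> 'n \<Rightarrow> 'n \<Rightarrow> real^'n \<Rightarrow> real"
  where "riemann g l k i j p =
    partial i (christoffel g l j k) p - partial j (christoffel g l i k) p
    + (\<Sum>m\<in>UNIV. christoffel g l i m p * christoffel g m j k p
                 - christoffel g l j m p * christoffel g m i k p)"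

definition gauss_curvature :: "(real^2 \<Rightarrow> real^2^2) \<Rightarrow> real^2 \<Rightarrow> real"
  where "gauss_curvature g p =
    (\<Sum>l\<in>UNIV. g p $ 1 $ l * riemann g l 2 1 2 p) / det (g p)"

definition Ck1_embedding_on :: "nat \<Rightarrow> (real^'n::finite \<Rightarrow> 'b::real_normed_vector) \<Rightarrow> (real^'n) set \<Rightarrow> bool"
  where "Ck1_embedding_on k X S \<longleftrightarrow>
    Ck1_on k X S \<and>
    (\<forall>p\<in>S. inj (frechet_derivative X (at p))) \<and>
    (\<exists>Y. homeomorphism S (X ` S) X Y)"

text \<open>The pullback under \<open>X\<close> of the flat metric of the target is \<open>g\<close>.\<close>

definition isometric_on ::
    "(real^'n::finite \<Rightarrow> real^'n^'n) \<Rightarrow> (real^'n \<Rightarrow> 'b::real_inner) \<Rightarrow> (real^'n) set \<Rightarrow> bool"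
  where "isometric_on g X S \<longleftrightarrow>
    (\<forall>p\<in>S. \<forall>v w. frechet_derivative X (at p) v \<bullet> frechet_derivative X (at p) w = v \<bullet> (g p *v w))"

end

theory Submission
  imports Defs
begin

text \<open>
  Write \<open>\<nabla>u\<close> for the gradient. For a graph, \<open>g = I + \<nabla>u \<otimes> \<nabla>u\<close>, so all products
  \<open>\<partial>\<^sub>i u \<partial>\<^sub>j u\<close> are \<open>C\<^sup>4\<close>. Away from the critical points of \<open>u\<close> one factor is a nonvanishing
  root of a \<open>C\<^sup>4\<close> function, so the gradient itself is \<open>C\<^sup>4\<close> there
  (\<open>v_C4_off_crit\<close>). The only difficulty is at the critical points.

  The first step shows that the origin is the only one. At a critical point \<open>p \<noteq> 0\<close> the first
  derivatives of \<open>g\<close> vanish, and positive curvature forces \<open>p\<close> to be an isolated zero of them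
  (\<open>crit_isolated\<close>). Hence there are only countably many critical points, and the complement of
  these and of the origin is connected. On this complement the curvature is
  \<open>det D\<^sup>2u / (1 + \<bar>\<nabla>u\<bar>\<^sup>2)\<^sup>2\<close>, so \<open>D\<^sup>2u\<close> is definite with a constant sign. A countable
  exceptional set does not affect monotonicity, so \<open>u\<close> or \<open>-u\<close> has monotone derivative along every
  line, and a second critical point is impossible (\<open>crit_eq\<close>).

  The second step bounds the third derivatives near the origin. For a direction \<open>e\<close> the function
  \<open>(\<partial>\<^sub>e u)\<^sup>2 = g(e, e) - \<bar>e\<bar>\<^sup>2\<close> is \<open>C\<^sup>4\<close>, and its root \<open>\<partial>\<^sub>e u\<close> is monotone along lines in
  direction \<open>e\<close>. For a monotone root of a \<open>C\<^sup>4\<close> function of one variable the second derivative is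
  bounded by a constant that depends only on a bound of the first four derivatives of the square and
  on the length of the interval (\<open>monotone_root_second_derivative_bound\<close>). This bounds
  \<open>\<partial>\<^sub>e\<^sub>e\<^sub>e u\<close> uniformly on the punctured disc, and four directions determine all third derivatives.
  So \<open>D\<^sup>2u\<close> is Lipschitz on the punctured disc and extends over the origin
  (\<open>Ck1_on_remove_point\<close>).
\<close>

section \<open>Calculus with partial derivatives\<close>

lemma partial_eq:
  assumes "(f has_derivative D) (at p)"
  shows "partial i f p = D (axis i 1)"
  using frechet_derivative_at[OF assms] by (simp add: partial_def)

lemma has_derivative_partials:
  fixes f :: "real^'n::finite \<Rightarrow> 'b::real_normed_vector"
  assumes "f differentiable (at p)"
  shows "(f has_derivative (\<lambda>h. \<Sum>i\<in>UNIV. h $ i *\<^sub>R partial i f p)) (at p)"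
proof -
  let ?D = "frechet_derivative f (at p)"
  have D: "(f has_derivative ?D) (at p)"
    using assms frechet_derivative_works by blast
  then have lin: "linear ?D" by (rule has_derivative_linear)
  have "?D h = (\<Sum>i\<in>UNIV. h $ i *\<^sub>R partial i f p)" for h
  proof -
    have "?D h = ?D (\<Sum>i\<in>UNIV. h $ i *\<^sub>R axis i 1)"
      using basis_expansion[of h] by (simp add: scalar_mult_eq_scaleR)
    also have "\<dots> = (\<Sum>i\<in>UNIV. h $ i *\<^sub>R ?D (axis i 1))"
      by (simp add: linear_sum[OF lin] linear_cmul[OF lin])
    finally show ?thesis by (simp add: partial_def)
  qed
  then show ?thesis using D by (metis (no_types, lifting) ext)
qed

lemma partial_cong:
  assumes "open S" "p \<in> S" "\<And>q. q \<in> S \<Longrightarrow> f q = h q"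
  shows "partial i f p = partial i h p"
proof -
  have "(f has_derivative D) (at p) \<longleftrightarrow> (h has_derivative D) (at p)" for D
    using has_derivative_transform_within_open[OF _ assms(1,2), of f D UNIV h]
      has_derivative_transform_within_open[OF _ assms(1,2), of h D UNIV f] assms(3) by auto
  then show ?thesis by (simp add: partial_def frechet_derivative_def)
qed

lemma differentiable_cong_open:
  assumes "open S" "p \<in> S" "\<And>q. q \<in> S \<Longrightarrow> f q = h q" "f differentiable (at p)"
  shows "h differentiable (at p)"
  using assms has_derivative_transform_within_open[OF _ assms(1,2), of f _ UNIV h]
  unfolding differentiable_def by blast

lemma partial_bounded_linear:
  assumes "bounded_linear L" "f differentiable (at p)"
  shows "partial i (\<lambda>q. L (f q)) p = L (partial i f p)"
proof -
  have "(f has_derivative frechet_derivative f (at p)) (at p)"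
    using assms(2) frechet_derivative_works by blast
  from bounded_linear.has_derivative[OF assms(1) this] show ?thesis
    using partial_eq by (fastforce simp: partial_def)
qed

lemma differentiable_bounded_linear:
  assumes "bounded_linear L" "f differentiable (at p)"
  shows "(\<lambda>q. L (f q)) differentiable (at p)"
  using assms bounded_linear.has_derivative unfolding differentiable_def by blast

lemma partial_const [simp]: "partial i (\<lambda>q. c) p = 0"
  by (subst partial_eq[OF has_derivative_const]) simp

lemma partial_add:
  assumes "f differentiable (at p)" "h differentiable (at p)"
  shows "partial i (\<lambda>q. f q + h q) p = partial i f p + partial i h p"
  using assms unfolding frechet_derivative_works
  by (subst partial_eq[OF has_derivative_add]) (auto simp: partial_def)

lemma partial_diff:
  assumes "f differentiable (at p)" "h differentiable (at p)"
  shows "partial i (\<lambda>q. f q - h q) p = partial i f p - partial i h p"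
  using assms unfolding frechet_derivative_works
  by (subst partial_eq[OF has_derivative_diff]) (auto simp: partial_def)

lemma partial_mult:
  fixes f h :: "real^'n::finite \<Rightarrow> real"
  assumes "f differentiable (at p)" "h differentiable (at p)"
  shows "partial i (\<lambda>q. f q * h q) p = f p * partial i h p + partial i f p * h p"
  using assms unfolding frechet_derivative_works
  by (subst partial_eq[OF has_derivative_mult]) (auto simp: partial_def)

lemma partial_inverse:
  fixes f :: "real^'n::finite \<Rightarrow> real"
  assumes "f differentiable (at p)" "f p \<noteq> 0"
  shows "partial i (\<lambda>q. inverse (f q)) p = - (inverse (f p) * partial i f p * inverse (f p))"
  using assms unfolding frechet_derivative_works
  by (subst partial_eq[OF Deriv.has_derivative_inverse]) (auto simp: partial_def)

lemma has_real_derivative_line: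
  fixes f :: "real^'n::finite \<Rightarrow> real"
  assumes "f differentiable (at (p + t *\<^sub>R e))"
  shows "((\<lambda>t. f (p + t *\<^sub>R e)) has_real_derivative
    (\<Sum>i\<in>UNIV. e $ i * partial i f (p + t *\<^sub>R e))) (at t)"
proof -
  have l: "((\<lambda>t. p + t *\<^sub>R e) has_derivative (\<lambda>h. h *\<^sub>R e)) (at t)"
    by (auto intro!: derivative_eq_intros)
  show ?thesis
    by (rule has_derivative_imp_has_field_derivative[OF
          has_derivative_compose[OF l has_derivative_partials[OF assms]]])
      (simp add: sum_distrib_left mult.assoc)
qed

text \<open>
  Young's theorem. The second difference of \<open>f\<close> over the parallelogram with sides \<open>s e\<^sub>i\<close>
  and \<open>s e\<^sub>j\<close> is symmetric in \<open>i\<close> and \<open>j\<close>; the mean value theorem in direction \<open>e\<^sub>i\<close>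
  evaluates it as \<open>s\<^sup>2\<close> times the \<open>j\<close>-th partial derivative of the \<open>i\<close>-th one, up to
  \<open>o(s\<^sup>2)\<close>.
\<close>

lemma second_difference_partial:
  fixes f :: "real^'n::finite \<Rightarrow> real"
  assumes S: "open S" "p \<in> S" and f: "\<And>q. q \<in> S \<Longrightarrow> f differentiable (at q)"
    and fi: "partial i f differentiable (at p)" and e: "0 < e"
  shows "\<exists>d>0. \<forall>s. 0 < s \<and> s < d \<longrightarrow>
    \<bar>f (p + s *\<^sub>R axis i 1 + s *\<^sub>R axis j 1) - f (p + s *\<^sub>R axis i 1) - f (p + s *\<^sub>R axis j 1) + f p
      - s\<^sup>2 * partial j (partial i f) p\<bar> \<le> e * s\<^sup>2"
proof -
  define D where "D = frechet_derivative (partial i f) (at p)"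
  have D: "(partial i f has_derivative D) (at p)"
    using fi frechet_derivative_works D_def by blast
  then have lin: "linear D" by (rule has_derivative_linear)
  from D obtain d1 where d1: "d1 > 0" and D1: "\<And>y. norm (y - p) < d1 \<Longrightarrow>
      norm (partial i f y - partial i f p - D (y - p)) \<le> (e/3) * norm (y - p)"
    using e unfolding has_derivative_at_alt by (meson divide_pos_pos zero_less_numeral)
  obtain d2 where d2: "d2 > 0" "ball p d2 \<subseteq> S" using S open_contains_ball by blast
  let ?a = "axis i 1 :: real^'n" and ?b = "axis j 1 :: real^'n"
  have ne: "norm (\<theta> *\<^sub>R ?a + s *\<^sub>R ?b) \<le> \<bar>\<theta>\<bar> + \<bar>s\<bar>" "norm (\<theta> *\<^sub>R ?a) = \<bar>\<theta>\<bar>" for \<theta> s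
    using norm_triangle_ineq[of "\<theta> *\<^sub>R ?a" "s *\<^sub>R ?b"] by (auto simp: norm_axis_1)
  show ?thesis
  proof (intro exI[of _ "min (d1/2) (d2/2)"] conjI allI impI)
    show "min (d1/2) (d2/2) > 0" using d1 d2 by auto
    fix s assume s: "0 < s \<and> s < min (d1/2) (d2/2)"
    define \<phi> where "\<phi> t = f (p + t *\<^sub>R ?a + s *\<^sub>R ?b) - f (p + t *\<^sub>R ?a)" for t
    have inS: "p + t *\<^sub>R ?a + s *\<^sub>R ?b \<in> S" "p + t *\<^sub>R ?a \<in> S" if "0 \<le> t" "t \<le> s" for t
    proof -
      have dp: "dist p (p + h) = norm h" for h :: "real^'n" by (simp add: dist_norm)
      have "dist p (p + t *\<^sub>R ?a + s *\<^sub>R ?b) = norm (t *\<^sub>R ?a + s *\<^sub>R ?b)"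
        using dp[of "t *\<^sub>R ?a + s *\<^sub>R ?b"] by (simp add: add.assoc)
      then show "p + t *\<^sub>R ?a + s *\<^sub>R ?b \<in> S" using ne(1)[of t s] that s d2 by auto
      have "dist p (p + t *\<^sub>R ?a) = norm (t *\<^sub>R ?a)"
        by (rule dp)
      then show "p + t *\<^sub>R ?a \<in> S" using ne(2)[of t] that s d2 by auto
    qed
    have der: "((\<lambda>t. f (w + t *\<^sub>R ?a)) has_real_derivative partial i f (w + t *\<^sub>R ?a)) (at t)"
      if "w + t *\<^sub>R ?a \<in> S" for w t
      using has_real_derivative_line[OF f[OF that]] by (simp add: axis_def if_distrib if_distribR cong: if_cong)
    have "\<exists>t. 0 < t \<and> t < s \<and> \<phi> s - \<phi> 0 = (s - 0) *
        (partial i f (p + t *\<^sub>R ?a + s *\<^sub>R ?b) - partial i f (p + t *\<^sub>R ?a))"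
    proof (rule MVT2)
      show "0 < s" using s by simp
      fix t assume t: "0 \<le> t" "t \<le> s"
      have "((\<lambda>t. f ((p + s *\<^sub>R ?b) + t *\<^sub>R ?a) - f (p + t *\<^sub>R ?a)) has_real_derivative
        partial i f ((p + s *\<^sub>R ?b) + t *\<^sub>R ?a) - partial i f (p + t *\<^sub>R ?a)) (at t)"
        by (intro DERIV_diff der) (use inS[OF t] in \<open>auto simp: algebra_simps\<close>)
      then show "(\<phi> has_real_derivative
        partial i f (p + t *\<^sub>R ?a + s *\<^sub>R ?b) - partial i f (p + t *\<^sub>R ?a)) (at t)"
        unfolding \<phi>_def by (simp add: algebra_simps)
    qed
    then obtain t where t: "0 < t" "t < s" and mv: "\<phi> s - \<phi> 0 = s *
        (partial i f (p + t *\<^sub>R ?a + s *\<^sub>R ?b) - partial i f (p + t *\<^sub>R ?a))" by auto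
    let ?y = "p + t *\<^sub>R ?a + s *\<^sub>R ?b" and ?z = "p + t *\<^sub>R ?a"
    have yz: "?y - p = t *\<^sub>R ?a + s *\<^sub>R ?b" "?z - p = t *\<^sub>R ?a" by auto
    have Dd: "D (?y - p) - D (?z - p) = s * partial j (partial i f) p"
      unfolding yz linear_add[OF lin] linear_cmul[OF lin] by (simp add: partial_def D_def)
    have n1: "norm (?y - p) \<le> 2 * s" "norm (?z - p) \<le> s"
      unfolding yz using ne(1)[of t s] ne(2)[of t] t by auto
    have "\<bar>partial i f ?y - partial i f p - D (?y - p)\<bar> \<le> (e/3) * norm (?y - p)"
      using D1[of ?y] n1 s by auto
    also have "\<dots> \<le> (e/3) * (2 * s)" using n1 e by (intro mult_left_mono) auto
    finally have b1: "\<bar>partial i f ?y - partial i f p - D (?y - p)\<bar> \<le> (e/3) * (2 * s)" .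
    have "\<bar>partial i f ?z - partial i f p - D (?z - p)\<bar> \<le> (e/3) * norm (?z - p)"
      using D1[of ?z] n1 s by auto
    also have "\<dots> \<le> (e/3) * s" using n1 e by (intro mult_left_mono) auto
    finally have b2: "\<bar>partial i f ?z - partial i f p - D (?z - p)\<bar> \<le> (e/3) * s" .
    have b3: "\<bar>partial i f ?y - partial i f ?z - s * partial j (partial i f) p\<bar> \<le> e * s"
      using b1 b2 Dd unfolding abs_le_iff by (auto simp: field_simps)
    have "f (p + s *\<^sub>R ?a + s *\<^sub>R ?b) - f (p + s *\<^sub>R ?a) - f (p + s *\<^sub>R ?b) + f p = \<phi> s - \<phi> 0"
      by (simp add: \<phi>_def)
    also have "\<dots> = s * (partial i f ?y - partial i f ?z)" by (rule mv)
    finally have eq: "f (p + s *\<^sub>R ?a + s *\<^sub>R ?b) - f (p + s *\<^sub>R ?a) - f (p + s *\<^sub>R ?b) + f p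
        - s\<^sup>2 * partial j (partial i f) p
      = s * (partial i f ?y - partial i f ?z - s * partial j (partial i f) p)"
      by (simp add: power2_eq_square algebra_simps)
    show "\<bar>f (p + s *\<^sub>R ?a + s *\<^sub>R ?b) - f (p + s *\<^sub>R ?a) - f (p + s *\<^sub>R ?b) + f p
        - s\<^sup>2 * partial j (partial i f) p\<bar> \<le> e * s\<^sup>2"
      unfolding eq using mult_left_mono[OF b3, of s] s
      by (simp add: abs_mult power2_eq_square mult_ac)
  qed
qed

lemma partial_commute:
  fixes f :: "real^'n::finite \<Rightarrow> real"
  assumes S: "open S" "p \<in> S" and f: "\<And>q. q \<in> S \<Longrightarrow> f differentiable (at q)"
    and fi: "\<And>i. partial i f differentiable (at p)"
  shows "partial i (partial j f) p = partial j (partial i f) p"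
proof (rule ccontr)
  assume ne: "partial i (partial j f) p \<noteq> partial j (partial i f) p"
  define e where "e = \<bar>partial i (partial j f) p - partial j (partial i f) p\<bar> / 3"
  have e: "e > 0" using ne by (simp add: e_def)
  have e3: "\<bar>partial i (partial j f) p - partial j (partial i f) p\<bar> = 3 * e" by (simp add: e_def)
  obtain d1 where d1: "d1 > 0" "\<And>s. 0 < s \<and> s < d1 \<Longrightarrow>
    \<bar>f (p + s *\<^sub>R axis i 1 + s *\<^sub>R axis j 1) - f (p + s *\<^sub>R axis i 1) - f (p + s *\<^sub>R axis j 1) + f p
      - s\<^sup>2 * partial j (partial i f) p\<bar> \<le> e * s\<^sup>2"
    using second_difference_partial[OF S f fi e, of i j] by blast
  obtain d2 where d2: "d2 > 0" "\<And>s. 0 < s \<and> s < d2 \<Longrightarrow>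
    \<bar>f (p + s *\<^sub>R axis j 1 + s *\<^sub>R axis i 1) - f (p + s *\<^sub>R axis j 1) - f (p + s *\<^sub>R axis i 1) + f p
      - s\<^sup>2 * partial i (partial j f) p\<bar> \<le> e * s\<^sup>2"
    using second_difference_partial[OF S f fi e, of j i] by blast
  define s where "s = min (d1/2) (d2/2)"
  have s: "0 < s" "s < d1" "s < d2" using d1 d2 by (auto simp: s_def)
  have c: "p + s *\<^sub>R axis j 1 + s *\<^sub>R axis i 1 = p + s *\<^sub>R axis i 1 + s *\<^sub>R axis j (1::real)"
    by (simp add: add_ac)
  have "\<bar>s\<^sup>2 * partial i (partial j f) p - s\<^sup>2 * partial j (partial i f) p\<bar> \<le> 2 * (e * s\<^sup>2)"
    using d1(2)[of s] d2(2)[of s] s unfolding c abs_le_iff by linarith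
  moreover have "\<bar>s\<^sup>2 * partial i (partial j f) p - s\<^sup>2 * partial j (partial i f) p\<bar> = s\<^sup>2 * (3 * e)"
    by (metis abs_mult abs_power2 e3 right_diff_distrib')
  ultimately have "0 \<le> - (e * s\<^sup>2)" by (simp add: algebra_simps)
  moreover have "e * s\<^sup>2 > 0" using e s by simp
  ultimately show False by linarith
qed

section \<open>Closure properties of \<open>C\<^sup>k\<close>\<close>

lemma Ck_on_cong:
  assumes "open S" "\<And>p. p \<in> S \<Longrightarrow> f p = h p" "Ck_on k f S"
  shows "Ck_on k h S"
  using assms(2,3)
proof (induction k arbitrary: f h)
  case 0
  then show ?case by (metis Ck_on.simps(1) continuous_on_cong)
next
  case (Suc k)
  have "h differentiable (at p)" if "p \<in> S" for p
    using differentiable_cong_open[OF assms(1) that, of f h] Suc that by auto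
  moreover have "Ck_on k (partial i h) S" for i
    by (rule Suc.IH[of "partial i f"]) (use Suc.prems partial_cong[OF assms(1), of _ f h] in auto)
  ultimately show ?case by simp
qed

lemma Ck_on_subset: "Ck_on k f S \<Longrightarrow> T \<subseteq> S \<Longrightarrow> Ck_on k f T"
  by (induction k arbitrary: f) (auto intro: continuous_on_subset)

lemma Ck_on_Suc_imp: "Ck_on (Suc k) f S \<Longrightarrow> Ck_on k f S"
proof (induction k arbitrary: f)
  case 0
  then show ?case
    by (auto intro!: continuous_at_imp_continuous_on differentiable_imp_continuous_within)
next
  case (Suc k)
  then show ?case by (metis Ck_on.simps(2))
qed

lemma Ck_on_le: "Ck_on k f S \<Longrightarrow> l \<le> k \<Longrightarrow> Ck_on l f S"
  by (induction k) (auto simp del: Ck_on.simps intro: Ck_on_Suc_imp elim: le_SucE)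

lemma Ck_on_continuous: "Ck_on k f S \<Longrightarrow> continuous_on S f"
  using Ck_on_le[of k f S 0] by simp

lemma Ck_on_Un:
  assumes "open S" "open T" "Ck_on k f S" "Ck_on k f T"
  shows "Ck_on k f (S \<union> T)"
  using assms(3,4)
  by (induction k arbitrary: f) (auto intro: continuous_on_open_Un[OF assms(1,2)])

lemma Ck_on_const: "Ck_on k (\<lambda>q. c) S"
proof (induction k arbitrary: c)
  case (Suc k)
  then show ?case by (simp add: partial_const[abs_def])
qed simp

lemma Ck_on_bounded_linear:
  assumes "open S" "bounded_linear L" "Ck_on k f S"
  shows "Ck_on k (\<lambda>q. L (f q)) S"
  using assms(3)
proof (induction k arbitrary: f)
  case 0
  then show ?case by (simp add: bounded_linear.continuous_on[OF assms(2)])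
next
  case (Suc k)
  have "Ck_on k (partial i (\<lambda>q. L (f q))) S" for i
    by (rule Ck_on_cong[OF assms(1) _ Suc.IH[of "partial i f"]])
      (use Suc.prems partial_bounded_linear[OF assms(2), of f] in auto)
  then show ?case using Suc.prems differentiable_bounded_linear[OF assms(2)] by auto
qed

lemma Ck_on_add:
  assumes "open S" "Ck_on k f S" "Ck_on k h S"
  shows "Ck_on k (\<lambda>q. f q + h q) S"
  using assms(2,3)
proof (induction k arbitrary: f h)
  case 0
  then show ?case by (auto intro: continuous_intros)
next
  case (Suc k)
  have "Ck_on k (partial i (\<lambda>q. f q + h q)) S" for i
    by (rule Ck_on_cong[OF assms(1) _ Suc.IH[of "partial i f" "partial i h"]])
      (use Suc.prems partial_add[of f _ h] in auto)
  then show ?case using Suc.prems by auto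
qed

lemma Ck_on_mult:
  fixes f h :: "real^'n::finite \<Rightarrow> real"
  assumes "open S" "Ck_on k f S" "Ck_on k h S"
  shows "Ck_on k (\<lambda>q. f q * h q) S"
  using assms(2,3)
proof (induction k arbitrary: f h)
  case 0
  then show ?case by (auto intro: continuous_intros)
next
  case (Suc k)
  have *: "Ck_on k f S" "Ck_on k h S" using Suc.prems Ck_on_Suc_imp by blast+
  have "Ck_on k (partial i (\<lambda>q. f q * h q)) S" for i
    by (rule Ck_on_cong[OF assms(1) _
        Ck_on_add[OF assms(1) Suc.IH[of f "partial i h"] Suc.IH[of "partial i f" h]]])
      (use Suc.prems partial_mult[of f _ h] * in auto)
  then show ?case using Suc.prems by (auto intro: differentiable_mult)
qed

lemma Ck_on_inverse:
  fixes f :: "real^'n::finite \<Rightarrow> real"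
  assumes "open S" "Ck_on k f S" "\<And>p. p \<in> S \<Longrightarrow> f p \<noteq> 0"
  shows "Ck_on k (\<lambda>q. inverse (f q)) S"
  using assms(2)
proof (induction k)
  case 0
  then show ?case using assms(3) by (auto intro: continuous_intros)
next
  case (Suc k)
  then have *: "Ck_on k (\<lambda>q. inverse (f q)) S" using Ck_on_Suc_imp by blast
  have "Ck_on k (partial i (\<lambda>q. inverse (f q))) S" for i
    by (rule Ck_on_cong[OF assms(1) _ Ck_on_mult[OF assms(1) Ck_on_const[of _ "-1"]
         Ck_on_mult[OF assms(1) Ck_on_mult[OF assms(1) *, of "partial i f"] *]]])
      (use Suc.prems assms(3) partial_inverse[of f] in auto)
  then show ?case using Suc.prems assms(3) by auto
qed

text \<open>
  A continuous root inherits the regularity of its square wherever it does not vanish: there it is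
  locally \<open>\<plusminus>\<surd>a\<close>, and its partial derivatives are those of the square divided by twice the root.
\<close>

lemma continuous_root_has_derivative:
  fixes v a :: "real^'n::finite \<Rightarrow> real"
  assumes S: "open S" "p \<in> S" and v: "continuous_on S v" "\<And>q. q \<in> S \<Longrightarrow> (v q)\<^sup>2 = a q"
    and a: "(a has_derivative D) (at p)" and nz: "v p \<noteq> 0"
  shows "(v has_derivative (\<lambda>h. D h / (2 * v p))) (at p)"
proof -
  define T where "T = {q \<in> S. v q * v p > 0}"
  have "continuous_on S (\<lambda>q. v q * v p)" using v(1) by (intro continuous_intros)
  then have T: "open T"
    using continuous_open_preimage[OF _ S(1) open_greaterThan[of 0]]
    unfolding T_def vimage_def Int_def greaterThan_iff mem_Collect_eq by blast
  have pT: "p \<in> T" using nz S by (auto simp: T_def zero_less_mult_iff linorder_neq_iff)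
  have vq: "v q = sgn (v p) * sqrt (a q)" if "q \<in> T" for q
    using that v(2)[of q, symmetric] by (auto simp: T_def sgn_if zero_less_mult_iff)
  have ap: "a p = (v p)\<^sup>2" using v(2)[OF S(2)] by simp
  have "((\<lambda>q. sgn (v p) * sqrt (a q)) has_derivative (\<lambda>h. D h / (2 * v p))) (at p)"
    using a ap nz
    by (auto intro!: derivative_eq_intros simp: sgn_if field_simps)
  then show ?thesis
    using has_derivative_transform_within_open[OF _ T pT] vq by (metis (no_types, lifting))
qed

lemma Ck_on_continuous_root:
  fixes v a :: "real^'n::finite \<Rightarrow> real"
  assumes S: "open S" and v: "continuous_on S v" "\<And>q. q \<in> S \<Longrightarrow> (v q)\<^sup>2 = a q"
    and nz: "\<And>q. q \<in> S \<Longrightarrow> v q \<noteq> 0" and a: "Ck_on k a S"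
  shows "Ck_on k v S"
  using a
proof (induction k)
  case 0
  then show ?case using v by simp
next
  case (Suc k)
  then have v': "Ck_on k v S" using Ck_on_Suc_imp by blast
  have der: "(v has_derivative (\<lambda>h. frechet_derivative a (at p) h / (2 * v p))) (at p)"
    if "p \<in> S" for p
    by (rule continuous_root_has_derivative[OF S that v _ nz[OF that]])
      (use Suc.prems that frechet_derivative_works in auto)
  have "Ck_on k (partial i v) S" for i
    by (rule Ck_on_cong[OF S _ Ck_on_mult[OF S Ck_on_mult[OF S Ck_on_const[of _ "1/2"] _]
            Ck_on_inverse[OF S v' nz]], of "partial i a"])
      (use Suc.prems partial_eq[OF der] in \<open>auto simp: partial_def field_simps\<close>)
  then show ?case using der by (auto simp: differentiable_def)
qed

section \<open>Monotonicity and removal of a point\<close>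

text \<open>
  Countably many exceptional points are harmless: some level between \<open>\<phi>(b)\<close> and \<open>\<phi>(a)\<close> is not
  taken at any of them, and \<open>\<phi>\<close> would have to cross it downwards for the last time at a point with
  positive derivative.
\<close>

lemma nondecreasing_countable_exceptions:
  fixes \<phi> :: "real \<Rightarrow> real"
  assumes ab: "a \<le> b" and cont: "continuous_on {a..b} \<phi>" and C: "countable C"
    and der: "\<And>t. a < t \<Longrightarrow> t < b \<Longrightarrow> t \<notin> C \<Longrightarrow> \<exists>l>0. (\<phi> has_real_derivative l) (at t)"
  shows "\<phi> a \<le> \<phi> b"
proof (rule ccontr)
  assume "\<not> \<phi> a \<le> \<phi> b"
  then have lt: "\<phi> b < \<phi> a" by simp
  have "uncountable ({\<phi> b<..<\<phi> a} - \<phi> ` C)"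
    using lt C by (intro uncountable_minus_countable) (auto simp: uncountable_open_interval)
  then obtain y where y: "\<phi> b < y" "y < \<phi> a" "y \<notin> \<phi> ` C"
    by (metis DiffE countable_empty ex_in_conv greaterThanLessThan_iff)
  define T where "T = {t \<in> {a..b}. y \<le> \<phi> t}"
  have "closed T" unfolding T_def
    by (intro continuous_on_closed_Collect_le cont continuous_on_const closed_atLeastAtMost)
  then have T: "compact T" unfolding T_def
    by (metis (no_types, lifting) bounded_closed_interval bounded_subset compact_eq_bounded_closed
        mem_Collect_eq subsetI)
  have "a \<in> T" using ab y by (simp add: T_def)
  then obtain s where s: "s \<in> T" "\<And>t. t \<in> T \<Longrightarrow> t \<le> s"
    using compact_attains_sup[OF T] by blast
  have sb: "a \<le> s" "s \<le> b" "y \<le> \<phi> s" using s(1) by (auto simp: T_def)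
  have "s \<noteq> b" using sb y by auto
  then have "s < b" using sb by simp
  have "continuous_on {s..b} \<phi>" using continuous_on_subset[OF cont] sb by auto
  then obtain t where t: "s \<le> t" "t \<le> b" "\<phi> t = y"
    using IVT2'[of \<phi> b y s] sb y by auto
  then have "t \<in> T" using sb by (simp add: T_def)
  then have ys: "\<phi> s = y" using s(2)[of t] t by auto
  then have "s \<notin> C" "s \<noteq> a" using y by auto
  then obtain l where "l > 0" "(\<phi> has_real_derivative l) (at s)"
    using der[of s] sb \<open>s < b\<close> by auto
  then obtain d where d: "d > 0" "\<And>h. h > 0 \<Longrightarrow> h < d \<Longrightarrow> \<phi> s < \<phi> (s + h)"
    using has_real_derivative_pos_inc_right[of \<phi> l s UNIV] by auto
  define h where "h = min (d / 2) ((b - s) / 2)"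
  have h: "h > 0" "h < d" "s + h \<le> b" using d \<open>s < b\<close> by (auto simp: h_def min_def field_simps)
  then have "s + h \<in> T" using d(2)[of h] ys sb by (auto simp: T_def)
  then show False using s(2)[of "s + h"] h by simp
qed

text \<open>
  A segment through the centre is replaced by a detour over the quarter turn of one end point,
  which is at most three times as long.
\<close>

lemma lipschitz_on_punctured_ball:
  fixes f :: "real^2 \<Rightarrow> 'b::real_normed_vector"
  assumes der: "\<And>x. x \<in> ball 0 \<rho> - {0} \<Longrightarrow> (f has_derivative f' x) (at x)"
    and B: "\<And>x. x \<in> ball 0 \<rho> - {0} \<Longrightarrow> onorm (f' x) \<le> B" and B0: "B \<ge> 0"
  shows "(3 * B)-lipschitz_on (ball 0 \<rho> - {0}) f"
proof (rule lipschitz_onI)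
  have seg: "norm (f x - f y) \<le> B * norm (x - y)"
    if "x \<in> ball 0 \<rho>" "y \<in> ball 0 \<rho>" "0 \<notin> closed_segment x y" for x y :: "real^2"
  proof -
    have sub: "closed_segment x y \<subseteq> ball 0 \<rho> - {0}"
      using closed_segment_subset[OF that(1,2) convex_ball] that(3) by blast
    show ?thesis
      by (rule differentiable_bound[of "closed_segment x y" f f'])
        (use subsetD[OF sub] in \<open>blast intro: der B has_derivative_at_withinI convex_closed_segment ends_in_segment\<close>)+
  qed
  fix x y :: "real^2" assume xy: "x \<in> ball 0 \<rho> - {0}" "y \<in> ball 0 \<rho> - {0}"
  show "dist (f x) (f y) \<le> 3 * B * dist x y"
  proof (cases "0 \<in> closed_segment x y")
    case False
    then have "norm (f x - f y) \<le> B * norm (x - y)" using seg xy by auto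
    also have "\<dots> \<le> 3 * B * norm (x - y)" using B0 by (intro mult_right_mono) auto
    finally show ?thesis by (simp add: dist_norm)
  next
    case True
    then obtain t where t: "0 \<le> t" "t \<le> 1" "0 = (1 - t) *\<^sub>R x + t *\<^sub>R y"
      unfolding in_segment by blast
    have t0: "t \<noteq> 0" using t(3) xy by auto
    define w :: "real^2" where "w = vector [- x $ 2, x $ 1]"
    have xw: "x \<bullet> w = 0" "norm w = norm x"
      by (auto simp: w_def inner_vec_def sum_2 norm_vec_def L2_set_def add.commute)
    have w0: "w \<noteq> 0" using xw xy by auto
    have y: "t *\<^sub>R y = - ((1 - t) *\<^sub>R x)" using t(3) by (simp add: eq_neg_iff_add_eq_0 add.commute)
    have t1: "t \<noteq> 1" using y xy by auto
    have yw: "y \<bullet> w = 0"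
    proof -
      have "t * (y \<bullet> w) = (t *\<^sub>R y) \<bullet> w" by simp
      also have "\<dots> = 0" unfolding y using xw by simp
      finally show ?thesis using t0 by simp
    qed
    have orth: "0 \<notin> closed_segment w z" if "z \<bullet> w = 0" "z \<noteq> 0" for z
    proof
      assume "0 \<in> closed_segment w z"
      then obtain a where a: "(1 - a) *\<^sub>R w + a *\<^sub>R z = 0" unfolding in_segment by auto
      then have "((1 - a) *\<^sub>R w + a *\<^sub>R z) \<bullet> w = 0" by simp
      then have "1 - a = 0" using that w0 by (simp add: inner_add_left)
      then show False using a that by simp
    qed
    have wb: "w \<in> ball 0 \<rho>" using xw xy by simp
    have "dist x y = norm x + norm y"
      using True between_mem_segment[of x y 0] by (simp add: between)
    have "norm (f x - f y) \<le> norm (f w - f x) + norm (f w - f y)"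
      using norm_triangle_ineq[of "f x - f w" "f w - f y"] by (simp add: norm_minus_commute)
    also have "\<dots> \<le> B * norm (w - x) + B * norm (w - y)"
      using seg[OF wb] orth xw yw xy by (intro add_mono) (auto simp: inner_commute)
    also have "\<dots> \<le> B * (norm w + norm x) + B * (norm w + norm y)"
      using B0 by (intro add_mono mult_left_mono norm_triangle_ineq4) auto
    also have "\<dots> = B * (3 * norm x + norm y)" using xw by (simp add: algebra_simps)
    also have "\<dots> \<le> B * (3 * dist x y)"
      using B0 \<open>dist x y = norm x + norm y\<close> by (intro mult_left_mono) auto
    finally show ?thesis by (simp add: dist_norm)
  qed
qed (use B0 in simp)

lemma has_derivative_limit_of_partials:
  fixes v :: "real^'n::finite \<Rightarrow> real"
  assumes \<rho>: "\<rho> > 0" and cont: "continuous_on (ball 0 \<rho>) v"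
    and der: "\<And>x. x \<in> ball 0 \<rho> - {0} \<Longrightarrow> v differentiable (at x)"
    and lim: "\<And>i. (partial i v \<longlongrightarrow> L i) (at 0)"
  shows "(v has_derivative (\<lambda>h. \<Sum>i\<in>UNIV. h $ i * L i)) (at 0)"
  unfolding has_derivative_at_alt
proof (intro conjI allI impI)
  show "bounded_linear (\<lambda>h. \<Sum>i\<in>UNIV. h $ i * L i)"
    by (intro bounded_linear_sum bounded_linear_mult_left[THEN bounded_linear_compose] bounded_linear_vec_nth)
  fix e :: real assume e: "e > 0"
  define N where "N = real CARD('n)"
  have N: "N > 0" by (simp add: N_def)
  have "\<forall>\<^sub>F x in at 0. \<forall>i. dist (partial i v x) (L i) < e / N"
    using lim e N by (intro eventually_all_finite) (auto intro!: tendstoD)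
  then obtain d where d: "d > 0" "\<And>x i. x \<noteq> 0 \<Longrightarrow> norm x < d \<Longrightarrow> \<bar>partial i v x - L i\<bar> < e / N"
    unfolding eventually_at by (auto simp: dist_real_def)
  show "\<exists>d>0. \<forall>y. norm (y - 0) < d \<longrightarrow>
      norm (v y - v 0 - (\<Sum>i\<in>UNIV. (y - 0) $ i * L i)) \<le> e * norm (y - 0)"
  proof (intro exI[of _ "min d \<rho>"] conjI allI impI)
    show "min d \<rho> > 0" using d \<rho> by simp
    fix y :: "real^'n" assume y: "norm (y - 0) < min d \<rho>"
    show "norm (v y - v 0 - (\<Sum>i\<in>UNIV. (y - 0) $ i * L i)) \<le> e * norm (y - 0)"
    proof (cases "y = 0")
      case False
      have small: "norm (t *\<^sub>R y) < min d \<rho>" if "0 \<le> t" "t \<le> 1" for t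
      proof -
        have "norm (t *\<^sub>R y) \<le> norm y" using that by (simp add: mult_left_le_one_le)
        then show ?thesis using y by simp
      qed
      define \<phi> where "\<phi> t = v (0 + t *\<^sub>R y)" for t
      have "\<exists>z. 0 < z \<and> z < 1 \<and> \<phi> 1 - \<phi> 0 =
          (1 - 0) * (\<lambda>h. h * (\<Sum>i\<in>UNIV. y $ i * partial i v (0 + z *\<^sub>R y))) 1"
      proof -
        have cont\<phi>: "continuous_on {0..1} \<phi>" unfolding \<phi>_def
          by (rule continuous_on_compose2[OF cont]) (use small in \<open>auto intro!: continuous_intros\<close>)
        have der\<phi>: "(\<phi> has_real_derivative (\<Sum>i\<in>UNIV. y $ i * partial i v (0 + t *\<^sub>R y))) (at t)"
          if "0 < t" "t < 1" for t
          unfolding \<phi>_def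
          by (rule has_real_derivative_line, rule der) (use that small[of t] False in auto)
        then have "\<phi> differentiable (at t)" if "0 < t" "t < 1" for t
          using that real_differentiable_def by blast
        then obtain l z where z: "0 < z" "z < 1" "(\<phi> has_real_derivative l) (at z)"
          "\<phi> 1 - \<phi> 0 = (1 - 0) * l"
          using MVT[OF zero_less_one cont\<phi>] by blast
        then show ?thesis using DERIV_unique[OF z(3) der\<phi>[OF z(1,2)]] by auto
      qed
      then obtain z where z: "0 < z" "z < 1" and mv: "v y - v 0 = (\<Sum>i\<in>UNIV. y $ i * partial i v (z *\<^sub>R y))"
        by (auto simp: \<phi>_def)
      have "v y - v 0 - (\<Sum>i\<in>UNIV. (y - 0) $ i * L i)
          = (\<Sum>i\<in>UNIV. y $ i * (partial i v (z *\<^sub>R y) - L i))"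
        by (simp add: mv sum_subtractf[symmetric] right_diff_distrib)
      also have "norm \<dots> \<le> (\<Sum>i\<in>(UNIV::'n set). norm y * (e / N))"
      proof (rule sum_norm_le)
        fix i :: 'n
        have "\<bar>partial i v (z *\<^sub>R y) - L i\<bar> < e / N"
          using d(2)[of "z *\<^sub>R y" i] small[of z] z False by auto
        then show "norm (y $ i * (partial i v (z *\<^sub>R y) - L i)) \<le> norm y * (e / N)"
          unfolding real_norm_def abs_mult
          by (intro mult_mono component_le_norm_cart) auto
      qed
      also have "\<dots> = e * norm y" using N by (simp add: N_def)
      finally show ?thesis by simp
    qed simp
  qed
qed

text \<open>
  A bound on the second derivatives near a puncture makes the first derivatives Lipschitz there, so
  they extend continuously over it; by the mean value theorem the extension is the derivative.
\<close>

lemma Ck1_on_remove_point: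
  fixes v :: "real^2 \<Rightarrow> real"
  assumes r: "r > 0" and cont: "continuous_on (ball 0 r) v"
    and C2: "Ck_on 2 v (ball 0 r - {0})"
    and bd: "\<And>\<rho>. \<rho> < r \<Longrightarrow> \<exists>B. \<forall>p\<in>ball 0 \<rho> - {0}. \<forall>i j. \<bar>partial j (partial i v) p\<bar> \<le> B"
  shows "Ck1_on 1 v (ball 0 r)"
proof -
  have C: "\<And>p. p \<in> ball 0 r - {0} \<Longrightarrow> v differentiable (at p)"
    "\<And>p i. p \<in> ball 0 r - {0} \<Longrightarrow> partial i v differentiable (at p)"
    using C2 by (auto simp: numeral_2_eq_2)
  have main: "v differentiable (at 0) \<and> (\<forall>i. \<exists>L. L-lipschitz_on (ball 0 \<rho>) (partial i v))"
    if \<rho>: "0 < \<rho>" "\<rho> < r" for \<rho>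
  proof -
    obtain B' where B': "\<And>p i j. p \<in> ball 0 \<rho> - {0} \<Longrightarrow> \<bar>partial j (partial i v) p\<bar> \<le> B'"
      using bd[OF \<rho>(2)] by blast
    define B where "B = max B' 0"
    have B: "B \<ge> 0" "\<And>p i j. p \<in> ball 0 \<rho> - {0} \<Longrightarrow> \<bar>partial j (partial i v) p\<bar> \<le> B"
      using B' by (auto simp: B_def max.coboundedI1)
    have "(3 * (2 * B))-lipschitz_on (ball 0 \<rho> - {0}) (partial i v)" for i
    proof (rule lipschitz_on_punctured_ball)
      fix x :: "real^2" assume x: "x \<in> ball 0 \<rho> - {0}"
      then show "(partial i v has_derivative (\<lambda>h. \<Sum>j\<in>UNIV. h $ j *\<^sub>R partial j (partial i v) x)) (at x)"
        using \<rho> by (intro has_derivative_partials C) auto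
      show "onorm (\<lambda>h. \<Sum>j\<in>UNIV. h $ j *\<^sub>R partial j (partial i v) x) \<le> 2 * B"
      proof (rule onorm_le)
        fix h :: "real^2"
        have "norm (\<Sum>j\<in>UNIV. h $ j *\<^sub>R partial j (partial i v) x) \<le> (\<Sum>j\<in>(UNIV::2 set). norm h * B)"
          by (rule sum_norm_le) (use component_le_norm_cart[of h] B(2)[OF x] B(1) in \<open>auto simp: abs_mult intro!: mult_mono\<close>)
        then show "norm (\<Sum>j\<in>UNIV. h $ j *\<^sub>R partial j (partial i v) x) \<le> 2 * B * norm h"
          by (simp add: mult_ac)
      qed
    qed (use B in simp)
    then have "\<exists>g. (3 * (2 * B))-lipschitz_on (closure (ball 0 \<rho> - {0})) g \<and>
        (\<forall>x\<in>ball 0 \<rho> - {0}. g x = partial i v x)" for i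
      by (rule lipschitz_extend_closure)
    then obtain G where G: "\<And>i. (3 * (2 * B))-lipschitz_on (closure (ball 0 \<rho> - {0})) (G i)"
      "\<And>i x. x \<in> ball 0 \<rho> - {0} \<Longrightarrow> G i x = partial i v x" by metis
    have "0 \<in> closure (ball (0::real^2) \<rho> - {0})"
      using \<rho> by (simp add: islimpt_in_closure[symmetric] islimpt_ball)
    then have cl: "ball 0 \<rho> \<subseteq> closure (ball (0::real^2) \<rho> - {0})"
      using closure_subset[of "ball (0::real^2) \<rho> - {0}"] by blast
    have Gl: "(3 * (2 * B))-lipschitz_on (ball 0 \<rho>) (G i)" for i
      using lipschitz_on_subset[OF G(1) cl] .
    have lim: "(partial i v \<longlongrightarrow> G i 0) (at 0)" for i
    proof -
      have "isCont (G i) 0"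
        using lipschitz_on_continuous_on[OF Gl] \<rho> by (simp add: continuous_on_eq_continuous_at)
      then have "(G i \<longlongrightarrow> G i 0) (at 0)" by (simp add: isCont_def)
      then show ?thesis
        by (rule Lim_transform_within_open[of _ _ _ _ "ball 0 \<rho>"]) (use \<rho> G(2) in auto)
    qed
    have der: "(v has_derivative (\<lambda>h. \<Sum>i\<in>UNIV. h $ i * G i 0)) (at 0)"
    proof (rule has_derivative_limit_of_partials[OF \<rho>(1) _ _ lim])
      show "continuous_on (ball 0 \<rho>) v"
        by (rule continuous_on_subset[OF cont subset_ball]) (use \<rho> in simp)
    qed (use \<rho> C(1) in auto)
    have "partial i v 0 = G i 0" for i
      unfolding partial_eq[OF der] by (simp add: axis_def if_distrib if_distribR cong: if_cong)
    then have "partial i v x = G i x" if "x \<in> ball 0 \<rho>" for i x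
      using G(2)[of x i] that by (cases "x = 0") auto
    then have "(3 * (2 * B))-lipschitz_on (ball 0 \<rho>) (partial i v)" for i
      using lipschitz_on_transform[OF Gl[of i], of "partial i v"] by simp
    then show ?thesis using der unfolding differentiable_def by blast
  qed
  have "v differentiable (at p)" if "p \<in> ball 0 r" for p
    using C(1)[of p] main[of "r/2"] that r by (cases "p = 0") auto
  moreover have "\<exists>L. L-lipschitz_on K (partial i v)" if K: "compact K" "K \<subseteq> ball 0 r" for K i
  proof -
    obtain \<rho> where "0 < \<rho>" "\<rho> < r" "K \<subseteq> ball 0 \<rho>"
    proof (cases "K = {}")
      case True
      then show thesis using that[of "r/2"] r by auto
    next
      case False
      then obtain x where x: "x \<in> K" "\<And>y. y \<in> K \<Longrightarrow> norm y \<le> norm x"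
        using compact_attains_sup[OF compact_continuous_image[OF continuous_on_norm_id K(1)]] by auto
      have xr: "norm x < r" using x(1) K(2) by auto
      show thesis
      proof (rule that[of "(norm x + r) / 2"])
        show "K \<subseteq> ball 0 ((norm x + r) / 2)"
        proof
          fix y assume "y \<in> K"
          then show "y \<in> ball 0 ((norm x + r) / 2)" using x(2)[of y] xr by simp
        qed
        show "0 < (norm x + r) / 2" using add_nonneg_pos[OF norm_ge_zero r, of x] by simp
        show "(norm x + r) / 2 < r" using xr by simp
      qed
    qed
    then show ?thesis using main[of \<rho>] lipschitz_on_subset by blast
  qed
  ultimately show ?thesis by simp
qed

section \<open>Monotone roots of \<open>C\<^sup>4\<close> functions of one variable\<close>

lemma taylor_remainder_bound:
  fixes F :: "nat \<Rightarrow> real \<Rightarrow> real"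
  assumes n: "n > 0"
    and der: "\<And>m t. m < n \<Longrightarrow> a \<le> t \<Longrightarrow> t \<le> b \<Longrightarrow> (F m has_real_derivative F (Suc m) t) (at t)"
    and bd: "\<And>t. a \<le> t \<Longrightarrow> t \<le> b \<Longrightarrow> \<bar>F n t\<bar> \<le> A"
    and c: "a \<le> c" "c \<le> b" and x: "a \<le> x" "x \<le> b"
  shows "\<bar>F 0 x - (\<Sum>m<n. F m c / fact m * (x - c) ^ m)\<bar> \<le> A / fact n * \<bar>x - c\<bar> ^ n"
proof (cases "x = c")
  case True
  have "(\<Sum>m<n. F m c / fact m * (x - c) ^ m) = (\<Sum>m\<in>{0}. F m c / fact m * (x - c) ^ m)"
    using n True by (intro sum.mono_neutral_right) auto
  then show ?thesis using True n by (simp add: power_0_left)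
next
  case False
  have "\<exists>t. (if x < c then x < t \<and> t < c else c < t \<and> t < x) \<and>
    F 0 x = (\<Sum>m<n. F m c / fact m * (x - c) ^ m) + F n t / fact n * (x - c) ^ n"
    by (rule Taylor[where a = a and b = b]) (use assms False in auto)
  then obtain t where t': "if x < c then x < t \<and> t < c else c < t \<and> t < x"
    and eq: "F 0 x = (\<Sum>m<n. F m c / fact m * (x - c) ^ m) + F n t / fact n * (x - c) ^ n"
    by blast
  have t: "a \<le> t" "t \<le> b" using t' c x by (auto split: if_splits)
  have "\<bar>F n t / fact n * (x - c) ^ n\<bar> = \<bar>F n t\<bar> / fact n * \<bar>x - c\<bar> ^ n"
    by (simp add: abs_mult power_abs)
  also have "\<dots> \<le> A / fact n * \<bar>x - c\<bar> ^ n"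
    by (intro mult_right_mono divide_right_mono bd t) auto
  finally show ?thesis using eq by simp
qed

text \<open>
  A root of a smooth nonnegative function can have a large second derivative, as
  \<open>\<surd>(t\<^sup>2 + \<epsilon>)\<close> shows. Monotonicity of the root on an interval of fixed length excludes this.
  Below, \<open>f = \<phi>\<^sup>2\<close> has at \<open>0\<close> the value \<open>\<delta>\<^sup>2\<close> and the derivatives that it gets from a root with
  \<open>\<phi>(0) = \<delta>\<close>, \<open>\<phi>'(0) = m\<close>, \<open>\<phi>''(0) = K\<close>. The natural length scale is \<open>\<surd>\<delta>\<close>: rescaled by it,
  \<open>f / \<delta>\<^sup>2\<close> has a bounded fourth derivative. If \<open>f\<close> stays in \<open>[0, \<delta>\<^sup>2]\<close> on a stretch of
  that length, interpolation at three points bounds its lower derivatives at the same scale.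
\<close>

lemma root_bound_by_interpolation:
  fixes \<delta> \<sigma> m K T A :: real and f :: "real \<Rightarrow> real"
  assumes pos: "\<delta> > 0" "\<sigma> > 0" "\<sigma>\<^sup>2 = \<delta>" and A: "A \<ge> 0"
    and taylor: "\<And>x. -\<sigma> \<le> x \<Longrightarrow> x \<le> 0 \<Longrightarrow>
      \<bar>f x - (\<delta>\<^sup>2 + 2 * \<delta> * m * x + (m\<^sup>2 + \<delta> * K) * x\<^sup>2 + T * x ^ 3)\<bar> \<le> A * x ^ 4"
    and f: "\<And>x. -\<sigma> \<le> x \<Longrightarrow> x \<le> 0 \<Longrightarrow> 0 \<le> f x \<and> f x \<le> \<delta>\<^sup>2"
  shows "\<bar>K\<bar> \<le> 54 * (1 + A) + 57 * (1 + A)\<^sup>2"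
proof -
  define D where "D = (1 + A) * \<delta>\<^sup>2"
  define b1 b2 b3 where "b1 = 2 * \<delta> * m * \<sigma>" and "b2 = (m\<^sup>2 + \<delta> * K) * \<sigma>\<^sup>2" and "b3 = T * \<sigma> ^ 3"
  have s4: "\<sigma> ^ 4 = \<delta>\<^sup>2" by (simp add: pos(3)[symmetric] power_mult[symmetric])
  have bd: "\<bar>b1 * (- c) + b2 * c\<^sup>2 - b3 * c ^ 3\<bar> \<le> D" if c: "0 \<le> c" "c \<le> 1" for c
  proof -
    have x: "-\<sigma> \<le> -(c * \<sigma>)" "-(c * \<sigma>) \<le> 0"
      using c pos(2) mult_left_le_one_le[of \<sigma> c] by auto
    have "c ^ 4 \<le> 1" using c by (simp add: power_le_one)
    then have "A * (-(c * \<sigma>)) ^ 4 \<le> A * \<delta>\<^sup>2"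
      using A by (simp add: power_mult_distrib s4 mult_left_mono mult_left_le_one_le)
    then have "\<bar>f (-(c * \<sigma>)) - (\<delta>\<^sup>2 + (b1 * (- c) + b2 * c\<^sup>2 - b3 * c ^ 3))\<bar> \<le> A * \<delta>\<^sup>2"
      using taylor[OF x] by (simp add: b1_def b2_def b3_def power_mult_distrib algebra_simps)
    then show ?thesis using f[OF x] by (simp add: D_def algebra_simps abs_le_iff)
  qed
  \<comment> \<open>Three sample points determine the three unknown coefficients.\<close>
  have y: "\<bar>- b1 + b2 - b3\<bar> \<le> D" "\<bar>- b1 / 2 + b2 / 4 - b3 / 8\<bar> \<le> D"
    "\<bar>- b1 / 4 + b2 / 16 - b3 / 64\<bar> \<le> D"
    using bd[of 1] bd[of "1/2"] bd[of "1/4"] by (simp_all add: power_divide)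
  have "\<bar>b1\<bar> \<le> 15 * D" "\<bar>b2\<bar> \<le> 54 * D" using y by (auto simp: abs_le_iff)
  then have "\<delta> * (2 * \<bar>m\<bar> * \<sigma>) \<le> \<delta> * (15 * (1 + A) * \<delta>)" and b2: "\<delta> * \<bar>m\<^sup>2 + \<delta> * K\<bar> \<le> \<delta> * (54 * (1 + A) * \<delta>)"
  proof -
    assume b: "\<bar>b1\<bar> \<le> 15 * D" "\<bar>b2\<bar> \<le> 54 * D"
    have D: "n * D = \<delta> * (n * (1 + A) * \<delta>)" for n by (simp add: D_def power2_eq_square)
    have "\<bar>b1\<bar> = \<delta> * (2 * \<bar>m\<bar> * \<sigma>)" using pos by (simp add: b1_def abs_mult)
    then show "\<delta> * (2 * \<bar>m\<bar> * \<sigma>) \<le> \<delta> * (15 * (1 + A) * \<delta>)" using b(1) D[of 15] by simp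
    have "\<bar>b2\<bar> = \<delta> * \<bar>m\<^sup>2 + \<delta> * K\<bar>" unfolding b2_def pos(3) using pos by (simp add: abs_mult)
    then show "\<delta> * \<bar>m\<^sup>2 + \<delta> * K\<bar> \<le> \<delta> * (54 * (1 + A) * \<delta>)" using b(2) D[of 54] by simp
  qed
  then have "2 * \<bar>m\<bar> * \<sigma> \<le> 15 * (1 + A) * \<delta>" using pos(1) mult_le_cancel_left_pos by blast
  then have "(2 * \<bar>m\<bar> * \<sigma>)\<^sup>2 \<le> (15 * (1 + A) * \<delta>)\<^sup>2" using pos by (intro power_mono) auto
  moreover have "(2 * \<bar>m\<bar> * \<sigma>)\<^sup>2 = \<delta> * (4 * m\<^sup>2)" by (simp add: power_mult_distrib pos(3))
  moreover have "(15 * (1 + A) * \<delta>)\<^sup>2 = \<delta> * (225 * (1 + A)\<^sup>2 * \<delta>)"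
    unfolding power_mult_distrib by (simp add: power2_eq_square)
  ultimately have "\<delta> * (4 * m\<^sup>2) \<le> \<delta> * (225 * (1 + A)\<^sup>2 * \<delta>)" by simp
  then have m: "4 * m\<^sup>2 \<le> 225 * (1 + A)\<^sup>2 * \<delta>" using pos(1) mult_le_cancel_left_pos by blast
  have "\<bar>m\<^sup>2 + \<delta> * K\<bar> \<le> 54 * (1 + A) * \<delta>" using b2 pos(1) mult_le_cancel_left_pos by blast
  then have "\<bar>\<delta> * K\<bar> \<le> 54 * (1 + A) * \<delta> + 57 * (1 + A)\<^sup>2 * \<delta>"
  proof -
    have "0 \<le> (1 + A)\<^sup>2 * \<delta>" using pos by simp
    then show ?thesis using m \<open>\<bar>m\<^sup>2 + \<delta> * K\<bar> \<le> 54 * (1 + A) * \<delta>\<close> zero_le_power2[of m]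
      unfolding abs_le_iff by linarith
  qed
  then have "\<delta> * \<bar>K\<bar> \<le> \<delta> * (54 * (1 + A) + 57 * (1 + A)\<^sup>2)"
    using pos(1) by (simp add: abs_mult algebra_simps)
  then show ?thesis using pos(1) mult_le_cancel_left_pos by blast
qed

text \<open>
  If instead \<open>\<phi>\<close> has a zero \<open>-d\<close> with \<open>d \<le> \<surd>\<delta>\<close>, then \<open>f\<close> vanishes to second order at \<open>-d\<close>,
  and the Taylor coefficients \<open>p, q\<close> of \<open>f\<close> there determine all quantities at \<open>0\<close>. Since
  \<open>f \<ge> 0\<close> at distance \<open>2\<delta>/d\<close> on both sides of \<open>-d\<close>, the cubic coefficient obeys
  \<open>\<bar>q\<bar> d \<le> C \<delta>\<close>; if that distance leaves the interval, then \<open>d\<close> itself is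
  \<open>O(\<delta>)\<close>. The quadratic coefficient then cancels from the expression for \<open>K\<close>.
\<close>

lemma root_bound_near_zero:
  fixes \<delta> d s m K p q A e0 e1 e2 :: real
  assumes pos: "\<delta> > 0" "d > 0" "d\<^sup>2 \<le> \<delta>" "s > 0" and A: "A \<ge> 0" and q: "\<bar>q\<bar> \<le> A"
    and nonneg: "\<And>t. \<bar>t\<bar> \<le> s / 2 \<Longrightarrow> 0 \<le> p * t\<^sup>2 + q * t ^ 3 + A * t ^ 4"
    and e0: "\<delta>\<^sup>2 = p * d\<^sup>2 + q * d ^ 3 + e0" "\<bar>e0\<bar> \<le> A * d ^ 4"
    and e1: "2 * \<delta> * m = 2 * p * d + 3 * q * d\<^sup>2 + e1" "\<bar>e1\<bar> \<le> A * d ^ 3"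
    and e2: "m\<^sup>2 + \<delta> * K = p + 3 * q * d + e2" "\<bar>e2\<bar> \<le> A * d\<^sup>2"
    and C1: "C1 = 1 + 5 * A + 4 * A / s" and C2: "C2 = (C1 + 3 * A) / 2"
  shows "\<bar>K\<bar> \<le> 2 * C2 + C2\<^sup>2 + 2 * C1 + 2 * A"
proof -
  have d4: "d ^ 4 \<le> \<delta> * d\<^sup>2"
    using mult_right_mono[OF pos(3), of "d\<^sup>2"] by (simp add: power2_eq_square power4_eq_xxxx mult.assoc)
  have d4': "d ^ 4 \<le> \<delta>\<^sup>2" using power_mono[OF pos(3), of 2] pos by (simp add: power_mult[symmetric])
  have Ad4: "A * d ^ 4 \<le> A * (\<delta> * d\<^sup>2)" by (rule mult_left_mono[OF d4 A])
  have qd: "\<bar>q\<bar> * d \<le> C1 * \<delta>"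
  proof (cases "2 * \<delta> / d \<le> s / 2")
    case True
    define \<tau> where "\<tau> = 2 * \<delta> / d"
    have \<tau>: "\<tau> > 0" "\<tau> \<le> s / 2" "\<tau> * d = 2 * \<delta>" using True pos by (auto simp: \<tau>_def)
    have "0 \<le> \<tau>\<^sup>2 * (p - \<bar>q\<bar> * \<tau> + A * \<tau>\<^sup>2)"
      using nonneg[of \<tau>] nonneg[of "-\<tau>"] \<tau>
      by (simp add: abs_if algebra_simps power2_eq_square power3_eq_cube power4_eq_xxxx split: if_splits)
    then have "\<bar>q\<bar> * \<tau> \<le> p + A * \<tau>\<^sup>2" using \<tau>(1) by (simp add: zero_le_mult_iff)
    then have "\<bar>q\<bar> * \<tau> * d\<^sup>2 \<le> (p + A * \<tau>\<^sup>2) * d\<^sup>2" by (rule mult_right_mono) simp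
    also have "\<dots> = \<delta>\<^sup>2 - q * d ^ 3 - e0 + A * (\<tau> * d)\<^sup>2"
      using e0(1) by (simp add: algebra_simps)
    also have "\<dots> \<le> \<delta>\<^sup>2 + \<bar>q\<bar> * d ^ 3 + A * \<delta>\<^sup>2 + 4 * (A * \<delta>\<^sup>2)"
    proof -
      have "- q * d ^ 3 \<le> \<bar>q\<bar> * d ^ 3" using pos by (intro mult_right_mono) auto
      moreover have "- e0 \<le> A * \<delta>\<^sup>2" using e0(2) mult_left_mono[OF d4' A] by linarith
      ultimately show ?thesis unfolding \<tau>(3) by (simp add: power_mult_distrib)
    qed
    also have "\<bar>q\<bar> * d ^ 3 \<le> \<bar>q\<bar> * (\<delta> * d)"
      using mult_right_mono[OF pos(3), of d] pos
      by (intro mult_left_mono) (auto simp: power2_eq_square power3_eq_cube)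
    finally have "\<bar>q\<bar> * \<tau> * d\<^sup>2 \<le> \<delta>\<^sup>2 + \<bar>q\<bar> * (\<delta> * d) + A * \<delta>\<^sup>2 + 4 * (A * \<delta>\<^sup>2)" by simp
    moreover have "\<bar>q\<bar> * \<tau> * d\<^sup>2 = 2 * (\<bar>q\<bar> * (\<delta> * d))"
    proof -
      have "\<bar>q\<bar> * \<tau> * d\<^sup>2 = \<bar>q\<bar> * d * (\<tau> * d)" by (simp add: power2_eq_square)
      then show ?thesis unfolding \<tau>(3) by (simp only: mult_ac)
    qed
    ultimately have "\<bar>q\<bar> * (\<delta> * d) \<le> \<delta>\<^sup>2 + 5 * (A * \<delta>\<^sup>2)" by linarith
    then have "\<delta> * (\<bar>q\<bar> * d) \<le> \<delta> * ((1 + 5 * A) * \<delta>)"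
      by (simp add: algebra_simps power2_eq_square)
    then have "\<bar>q\<bar> * d \<le> (1 + 5 * A) * \<delta>" using pos(1) mult_le_cancel_left_pos by blast
    also have "\<dots> \<le> C1 * \<delta>" using C1 A pos by (intro mult_right_mono) auto
    finally show ?thesis .
  next
    case False
    then have "d \<le> 4 * \<delta> / s" using pos by (simp add: field_simps)
    then have "\<bar>q\<bar> * d \<le> A * (4 * \<delta> / s)" using q pos A by (intro mult_mono) auto
    also have "\<dots> = (4 * A / s) * \<delta>" by simp
    also have "\<dots> \<le> C1 * \<delta>" using C1 A pos by (intro mult_right_mono) auto
    finally show ?thesis .
  qed
  have qd3: "\<bar>q * d ^ 3\<bar> \<le> C1 * (\<delta> * d\<^sup>2)"
    using mult_right_mono[OF qd, of "d\<^sup>2"] pos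
    by (simp add: abs_mult power2_eq_square power3_eq_cube algebra_simps)
  define \<epsilon> where "\<epsilon> = \<delta> - m * d"
  have "2 * \<delta> * \<epsilon> = 2 * \<delta>\<^sup>2 - (2 * \<delta> * m) * d"
    by (simp add: \<epsilon>_def algebra_simps power2_eq_square)
  also have "\<dots> = - (q * d ^ 3) + 2 * e0 - e1 * d"
    unfolding e0(1) e1(1) by (simp add: algebra_simps power2_eq_square power3_eq_cube)
  finally have eps: "2 * \<delta> * \<epsilon> = - (q * d ^ 3) + 2 * e0 - e1 * d" .
  have "\<bar>e1 * d\<bar> \<le> A * d ^ 4"
    using mult_right_mono[OF e1(2), of d] pos
    by (simp add: abs_mult power3_eq_cube power4_eq_xxxx mult.assoc)
  then have "\<bar>2 * \<delta> * \<epsilon>\<bar> \<le> C1 * (\<delta> * d\<^sup>2) + 3 * (A * (\<delta> * d\<^sup>2))"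
    using qd3 e0(2) Ad4 unfolding eps abs_le_iff by linarith
  then have "\<delta> * \<bar>\<epsilon>\<bar> \<le> \<delta> * (C2 * d\<^sup>2)"
    using pos unfolding C2 by (simp add: abs_mult algebra_simps)
  then have \<epsilon>: "\<bar>\<epsilon>\<bar> \<le> C2 * d\<^sup>2" using pos(1) mult_le_cancel_left_pos by blast
  then have "\<bar>\<epsilon>\<bar>\<^sup>2 \<le> (C2 * d\<^sup>2)\<^sup>2" by (intro power_mono) auto
  also have "\<dots> = C2\<^sup>2 * d ^ 4" by (simp add: power_mult_distrib power_mult[symmetric])
  also have "\<dots> \<le> C2\<^sup>2 * (\<delta> * d\<^sup>2)" by (rule mult_left_mono[OF d4]) simp
  finally have \<epsilon>2: "\<epsilon>\<^sup>2 \<le> C2\<^sup>2 * (\<delta> * d\<^sup>2)" by simp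
  have \<delta>\<epsilon>: "\<bar>\<delta> * \<epsilon>\<bar> \<le> C2 * (\<delta> * d\<^sup>2)"
    using mult_left_mono[OF \<epsilon>, of \<delta>] pos by (simp add: abs_mult algebra_simps)
  have "\<bar>e2 * d\<^sup>2\<bar> \<le> A * d ^ 4"
    using mult_right_mono[OF e2(2), of "d\<^sup>2"]
    by (simp add: abs_mult power2_eq_square power4_eq_xxxx mult.assoc)
  then have ed: "\<bar>e2 * d\<^sup>2\<bar> \<le> A * (\<delta> * d\<^sup>2)" "\<bar>e0\<bar> \<le> A * (\<delta> * d\<^sup>2)" using Ad4 e0(2) by auto
  have "\<delta> * d\<^sup>2 * K = (m\<^sup>2 + \<delta> * K) * d\<^sup>2 - (\<delta> - \<epsilon>)\<^sup>2"
    by (simp add: \<epsilon>_def algebra_simps power_mult_distrib)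
  also have "\<dots> = p * d\<^sup>2 + 3 * (q * d ^ 3) + e2 * d\<^sup>2 - (\<delta>\<^sup>2 - 2 * (\<delta> * \<epsilon>) + \<epsilon>\<^sup>2)"
    unfolding e2(1) by (simp add: algebra_simps power2_eq_square power3_eq_cube)
  also have "\<dots> = 2 * (\<delta> * \<epsilon>) - \<epsilon>\<^sup>2 + 2 * (q * d ^ 3) + e2 * d\<^sup>2 - e0"
    unfolding e0(1) by simp
  finally have K: "\<delta> * d\<^sup>2 * K = 2 * (\<delta> * \<epsilon>) - \<epsilon>\<^sup>2 + 2 * (q * d ^ 3) + e2 * d\<^sup>2 - e0" .
  have "\<bar>\<delta> * d\<^sup>2 * K\<bar> \<le> 2 * (C2 * (\<delta> * d\<^sup>2)) + C2\<^sup>2 * (\<delta> * d\<^sup>2) + 2 * (C1 * (\<delta> * d\<^sup>2))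
      + 2 * (A * (\<delta> * d\<^sup>2))"
    using \<delta>\<epsilon> \<epsilon>2 qd3 ed zero_le_power2[of \<epsilon>] unfolding K abs_le_iff by linarith
  then have "(\<delta> * d\<^sup>2) * \<bar>K\<bar> \<le> (\<delta> * d\<^sup>2) * (2 * C2 + C2\<^sup>2 + 2 * C1 + 2 * A)"
    using pos by (simp add: abs_mult algebra_simps)
  moreover have "\<delta> * d\<^sup>2 > 0" using pos by simp
  ultimately show ?thesis using mult_le_cancel_left_pos by blast
qed

text \<open>
  The sum of the bounds for the three situations distinguished in the next proof: no zero within
  distance \<open>\<surd>\<delta>\<close>, a zero within that distance, and \<open>\<delta>\<close> so large that this distance may
  leave the interval.
\<close>

definition root_const :: "real \<Rightarrow> real \<Rightarrow> real" where
  "root_const A s =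
    (let C1 = 1 + 5 * A + 4 * A / s; C2 = (C1 + 3 * A) / 2; \<delta>0 = (s / 4)\<^sup>2 in
      (54 * (1 + A) + 57 * (1 + A)\<^sup>2) + (2 * C2 + C2\<^sup>2 + 2 * C1 + 2 * A)
      + (A / 2 + (A / (2 * \<delta>0))\<^sup>2) / \<delta>0)"

text \<open>
  The numbers \<open>m\<close> and \<open>K\<close> enter only through the first two derivatives of \<open>\<phi>\<^sup>2\<close> at \<open>0\<close>,
  because the root may fail to be smooth elsewhere on the line. A negative value at \<open>0\<close> is
  reduced to a positive one by \<open>t \<mapsto> - \<phi>(-t)\<close>, which is again monotone.
\<close>

lemma monotone_root_second_derivative_bound_pos:
  fixes F :: "nat \<Rightarrow> real \<Rightarrow> real" and \<phi> :: "real \<Rightarrow> real"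
  assumes s: "s > 0"
    and der: "\<And>n t. n < 4 \<Longrightarrow> \<bar>t\<bar> \<le> s \<Longrightarrow> (F n has_real_derivative F (Suc n) t) (at t)"
    and bd: "\<And>n t. n \<le> 4 \<Longrightarrow> \<bar>t\<bar> \<le> s \<Longrightarrow> \<bar>F n t\<bar> \<le> A"
    and sq: "\<And>t. \<bar>t\<bar> \<le> s \<Longrightarrow> F 0 t = (\<phi> t)\<^sup>2"
    and cont: "continuous_on {-s..s} \<phi>" and mono: "mono_on {-s..s} \<phi>"
    and \<phi>0: "\<phi> 0 > 0"
    and m: "F 1 0 = 2 * \<phi> 0 * m" and K: "F 2 0 = 2 * m\<^sup>2 + 2 * \<phi> 0 * K"
  shows "\<bar>K\<bar> \<le> root_const A s"
proof -
  define \<delta> where "\<delta> = \<phi> 0"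
  have \<delta>: "\<delta> > 0" using \<phi>0 by (simp add: \<delta>_def)
  have A: "A \<ge> 0" using bd[of 0 0] s by simp
  define C1 C2 \<delta>0 where "C1 = 1 + 5 * A + 4 * A / s" and "C2 = (C1 + 3 * A) / 2"
    and "\<delta>0 = (s / 4)\<^sup>2"
  define c1 c2 c3 where "c1 = 54 * (1 + A) + 57 * (1 + A)\<^sup>2"
    and "c2 = 2 * C2 + C2\<^sup>2 + 2 * C1 + 2 * A" and "c3 = (A / 2 + (A / (2 * \<delta>0))\<^sup>2) / \<delta>0"
  have \<delta>0: "\<delta>0 > 0" using s by (simp add: \<delta>0_def)
  have rc: "root_const A s = c1 + c2 + c3"
    by (simp add: root_const_def Let_def C1_def C2_def \<delta>0_def c1_def c2_def c3_def)
  have nn: "c1 \<ge> 0" "c2 \<ge> 0" "c3 \<ge> 0"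
    using A s \<delta>0 by (auto simp: c1_def c2_def c3_def C1_def C2_def)
  have taylor: "\<bar>F j x - (\<Sum>i<n. F (i + j) c / fact i * (x - c) ^ i)\<bar> \<le> A / fact n * \<bar>x - c\<bar> ^ n"
    if "n > 0" "n + j = 4" "\<bar>c\<bar> \<le> s" "\<bar>x\<bar> \<le> s" for n j c x
  proof -
    have "\<bar>F (0 + j) x - (\<Sum>i<n. F (i + j) c / fact i * (x - c) ^ i)\<bar> \<le> A / fact n * \<bar>x - c\<bar> ^ n"
    proof (rule taylor_remainder_bound[of n "-s" s "\<lambda>i. F (i + j)" A c x])
      show "(F (i + j) has_real_derivative F (Suc i + j) t) (at t)"
        if "i < n" "- s \<le> t" "t \<le> s" for i t
        using der[of "i + j" t] that \<open>n + j = 4\<close> by auto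
      show "\<bar>F (n + j) t\<bar> \<le> A" if "- s \<le> t" "t \<le> s" for t
        using bd[of "n + j" t] that \<open>n + j = 4\<close> by auto
    qed (use that in auto)
    then show ?thesis by simp
  qed
  have t0: "\<bar>F 0 x - (F 0 c + F 1 c * (x - c) + F 2 c / 2 * (x - c)\<^sup>2 + F 3 c / 6 * (x - c) ^ 3)\<bar>
      \<le> A * (x - c) ^ 4" if "\<bar>c\<bar> \<le> s" "\<bar>x\<bar> \<le> s" for c x
  proof -
    have "A / fact 4 * \<bar>x - c\<bar> ^ 4 \<le> A * (x - c) ^ 4"
      using A by (simp add: fact_numeral mult_right_mono)
    then show ?thesis
      using taylor[of 4 0 c x] that by (simp add: eval_nat_numeral fact_numeral)
  qed
  have t1: "\<bar>F 1 x - (F 1 c + F 2 c * (x - c) + F 3 c / 2 * (x - c)\<^sup>2)\<bar> \<le> A * \<bar>x - c\<bar> ^ 3"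
    if "\<bar>c\<bar> \<le> s" "\<bar>x\<bar> \<le> s" for c x
  proof -
    have "A / fact 3 * \<bar>x - c\<bar> ^ 3 \<le> A * \<bar>x - c\<bar> ^ 3"
      using A by (intro mult_right_mono) (auto simp: fact_numeral)
    moreover have "(\<Sum>i<3. F (i + 1) c / fact i * (x - c) ^ i)
        = F 1 c + F 2 c * (x - c) + F 3 c / 2 * (x - c)\<^sup>2"
      by (simp add: eval_nat_numeral)
    ultimately show ?thesis using taylor[of 3 1 c x] that by simp
  qed
  have t2: "\<bar>F 2 x - (F 2 c + F 3 c * (x - c))\<bar> \<le> A * (x - c)\<^sup>2"
    if "\<bar>c\<bar> \<le> s" "\<bar>x\<bar> \<le> s" for c x
  proof -
    have "A / fact 2 * \<bar>x - c\<bar>\<^sup>2 \<le> A * (x - c)\<^sup>2"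
      using A by (simp add: fact_numeral mult_right_mono)
    then show ?thesis
      using taylor[of 2 2 c x] that by (simp add: eval_nat_numeral fact_numeral)
  qed
  have F00: "F 0 0 = \<delta>\<^sup>2" using sq[of 0] s by (simp add: \<delta>_def)
  \<comment> \<open>For \<open>\<delta> < \<delta>0\<close> the scale \<open>\<surd>\<delta>\<close> is below \<open>s / 4\<close>, so all points used stay in the interval.\<close>
  consider (large) "\<delta> \<ge> \<delta>0" | (zero) d where "d > 0" "d\<^sup>2 \<le> \<delta>" "d < s / 4" "\<phi> (-d) = 0"
    | (far) "\<delta> < \<delta>0" "\<And>t. - sqrt \<delta> \<le> t \<Longrightarrow> t \<le> 0 \<Longrightarrow> \<phi> t \<noteq> 0"
  proof (cases "\<delta> \<ge> \<delta>0 \<or> (\<forall>t. - sqrt \<delta> \<le> t \<and> t \<le> 0 \<longrightarrow> \<phi> t \<noteq> 0)")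
    case True
    then show thesis using that(1,3) by force
  next
    case False
    then obtain t where t: "- sqrt \<delta> \<le> t" "t \<le> 0" "\<phi> t = 0" and l: "\<delta> < \<delta>0" by auto
    have "(-t)\<^sup>2 \<le> (sqrt \<delta>)\<^sup>2" using t by (intro power_mono) auto
    moreover have "sqrt \<delta> < s / 4"
      using l s real_sqrt_less_mono[of \<delta> "(s / 4)\<^sup>2"] by (simp add: \<delta>0_def)
    moreover have "t \<noteq> 0" using t(3) \<phi>0 by auto
    ultimately show thesis using that(2)[of "-t"] t \<delta> by auto
  qed
  then show ?thesis
  proof cases
    case large
    have "\<bar>m\<bar> * (2 * \<delta>) \<le> A"
      using bd[of 1 0] m s \<delta> by (simp add: abs_mult \<delta>_def algebra_simps)
    then have "\<bar>m\<bar> \<le> A / (2 * \<delta>)" using \<delta> by (simp add: field_simps)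
    also have "\<dots> \<le> A / (2 * \<delta>0)" using A large \<delta>0 by (intro divide_left_mono) auto
    finally have "\<bar>m\<bar>\<^sup>2 \<le> (A / (2 * \<delta>0))\<^sup>2" by (intro power_mono) auto
    moreover have "\<bar>2 * m\<^sup>2 + 2 * (\<delta> * K)\<bar> \<le> A" using bd[of 2 0] K s by (simp add: \<delta>_def)
    ultimately have "\<bar>\<delta> * K\<bar> \<le> A / 2 + (A / (2 * \<delta>0))\<^sup>2"
      using zero_le_power2[of m] zero_le_power2[of "A / (2 * \<delta>0)"]
      unfolding abs_le_iff power2_abs by linarith
    then have "\<bar>K\<bar> \<le> (A / 2 + (A / (2 * \<delta>0))\<^sup>2) / \<delta>"
      using \<delta> by (simp add: abs_mult field_simps)
    also have "\<dots> \<le> c3" unfolding c3_def using A large \<delta>0 by (intro divide_left_mono) auto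
    finally show ?thesis using nn rc by linarith
  next
    case zero
    have ds: "\<bar>-d\<bar> \<le> s" using zero s by auto
    have f0: "F 0 (-d) = 0" using sq[OF ds] zero by simp
    have f1: "F 1 (-d) = 0"
    proof (rule DERIV_local_min[of "F 0" "F 1 (-d)" "-d" "s / 2"])
      show "(F 0 has_real_derivative F 1 (-d)) (at (-d))" using der[of 0 "-d"] ds by simp
      show "\<forall>y. \<bar>-d - y\<bar> < s / 2 \<longrightarrow> F 0 (-d) \<le> F 0 y"
      proof (intro allI impI)
        fix y assume "\<bar>-d - y\<bar> < s / 2"
        then have "\<bar>y\<bar> \<le> s" using zero s by linarith
        then show "F 0 (-d) \<le> F 0 y" using f0 sq[of y] by simp
      qed
    qed (use s in auto)
    define p q where "p = F 2 (-d) / 2" and "q = F 3 (-d) / 6"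
    define e0 e1 e2 where "e0 = \<delta>\<^sup>2 - (p * d\<^sup>2 + q * d ^ 3)"
      and "e1 = 2 * \<delta> * m - (2 * p * d + 3 * q * d\<^sup>2)"
      and "e2 = m\<^sup>2 + \<delta> * K - (p + 3 * q * d)"
    have "\<bar>K\<bar> \<le> c2"
      unfolding c2_def
    proof (rule root_bound_near_zero[where \<delta> = \<delta> and d = d and s = s and m = m and p = p
          and q = q and ?e0.0 = e0 and ?e1.0 = e1 and ?e2.0 = e2])
      show "\<bar>q\<bar> \<le> A" using bd[of 3 "-d"] ds by (simp add: q_def)
      show "0 \<le> p * t\<^sup>2 + q * t ^ 3 + A * t ^ 4" if "\<bar>t\<bar> \<le> s / 2" for t
      proof -
        have "\<bar>t - d\<bar> \<le> s" using that zero s by linarith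
        then have "\<bar>F 0 (t - d) - (p * t\<^sup>2 + q * t ^ 3)\<bar> \<le> A * t ^ 4" and "0 \<le> F 0 (t - d)"
          using t0[OF ds, of "t - d"] sq[of "t - d"] f0 f1 by (simp_all add: p_def q_def)
        then show ?thesis by linarith
      qed
      show "\<bar>e0\<bar> \<le> A * d ^ 4"
        using t0[OF ds, of 0] s f0 f1 by (simp add: e0_def p_def q_def F00)
      show "\<bar>e1\<bar> \<le> A * d ^ 3"
        using t1[OF ds, of 0] s f1 zero m by (simp add: e1_def p_def q_def \<delta>_def)
      show "\<bar>e2\<bar> \<le> A * d\<^sup>2"
        using t2[OF ds, of 0] s K by (simp add: e2_def p_def q_def \<delta>_def abs_le_iff)
    qed (use zero \<delta> s A in \<open>auto simp: e0_def e1_def e2_def C1_def C2_def\<close>)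
    then show ?thesis using nn rc by linarith
  next
    case far
    define \<sigma> where "\<sigma> = sqrt \<delta>"
    have \<sigma>: "\<sigma> > 0" "\<sigma>\<^sup>2 = \<delta>" using \<delta> by (auto simp: \<sigma>_def)
    have \<sigma>s: "\<sigma> < s" using far(1) s real_less_lsqrt[of "s/4" \<delta>] by (simp add: \<delta>0_def \<sigma>_def)
    have f: "0 \<le> F 0 x \<and> F 0 x \<le> \<delta>\<^sup>2" if x: "-\<sigma> \<le> x" "x \<le> 0" for x
    proof -
      have "\<phi> x > 0"
      proof (rule ccontr)
        assume "\<not> \<phi> x > 0"
        moreover have "continuous_on {x..0} \<phi>"
          using continuous_on_subset[OF cont] x \<sigma>s s by auto
        ultimately obtain y where "x \<le> y" "y \<le> 0" "\<phi> y = 0"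
          using IVT'[of \<phi> x 0 0] x \<phi>0 by auto
        then show False using far(2)[of y] x by (simp add: \<sigma>_def)
      qed
      moreover have "\<phi> x \<le> \<delta>"
        unfolding \<delta>_def by (rule mono_onD[OF mono]) (use x \<sigma>s s in auto)
      ultimately have "(\<phi> x)\<^sup>2 \<le> \<delta>\<^sup>2" by (intro power_mono) auto
      then show ?thesis using sq[of x] x \<sigma>s by auto
    qed
    have "\<bar>K\<bar> \<le> c1"
      unfolding c1_def
    proof (rule root_bound_by_interpolation[where f = "F 0" and \<delta> = \<delta> and \<sigma> = \<sigma> and m = m
          and T = "F 3 0 / 6"])
      fix x assume x: "-\<sigma> \<le> x" "x \<le> 0"
      have K': "F 2 0 / 2 = m\<^sup>2 + \<delta> * K" using K by (simp add: \<delta>_def)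
      have "F 0 0 + F 1 0 * (x - 0) + F 2 0 / 2 * (x - 0)\<^sup>2 + F 3 0 / 6 * (x - 0) ^ 3
          = \<delta>\<^sup>2 + 2 * \<delta> * m * x + (m\<^sup>2 + \<delta> * K) * x\<^sup>2 + F 3 0 / 6 * x ^ 3"
        unfolding F00 m K' by (simp add: \<delta>_def)
      then show "\<bar>F 0 x - (\<delta>\<^sup>2 + 2 * \<delta> * m * x + (m\<^sup>2 + \<delta> * K) * x\<^sup>2 + F 3 0 / 6 * x ^ 3)\<bar>
          \<le> A * x ^ 4"
        using t0[of 0 x] x \<sigma>s by simp
    qed (use \<sigma> \<delta> A f in auto)
    then show ?thesis using nn rc by linarith
  qed
qed

lemma monotone_root_second_derivative_bound:
  fixes F :: "nat \<Rightarrow> real \<Rightarrow> real" and \<phi> :: "real \<Rightarrow> real"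
  assumes s: "s > 0"
    and der: "\<And>n t. n < 4 \<Longrightarrow> \<bar>t\<bar> \<le> s \<Longrightarrow> (F n has_real_derivative F (Suc n) t) (at t)"
    and bd: "\<And>n t. n \<le> 4 \<Longrightarrow> \<bar>t\<bar> \<le> s \<Longrightarrow> \<bar>F n t\<bar> \<le> A"
    and sq: "\<And>t. \<bar>t\<bar> \<le> s \<Longrightarrow> F 0 t = (\<phi> t)\<^sup>2"
    and cont: "continuous_on {-s..s} \<phi>" and mono: "mono_on {-s..s} \<phi>"
    and \<phi>0: "\<phi> 0 \<noteq> 0"
    and m: "F 1 0 = 2 * \<phi> 0 * m" and K: "F 2 0 = 2 * m\<^sup>2 + 2 * \<phi> 0 * K"
  shows "\<bar>K\<bar> \<le> root_const A s"
proof (cases "\<phi> 0 > 0")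
  case True
  then show ?thesis using monotone_root_second_derivative_bound_pos[of s F A \<phi> m K] assms by blast
next
  case False
  define F' where "F' n t = (-1) ^ n * F n (- t)" for n t
  have "\<bar>- K\<bar> \<le> root_const A s"
  proof (rule monotone_root_second_derivative_bound_pos[of s F' A "\<lambda>t. - \<phi> (- t)" m "- K"])
    fix n t assume n: "n < (4::nat)" and t: "\<bar>t\<bar> \<le> s"
    have "((\<lambda>t. F n (- t)) has_real_derivative - F (Suc n) (- t)) (at t)"
      using der[OF n, of "- t"] t by (simp add: DERIV_mirror)
    from DERIV_cmult[OF this, of "(-1) ^ n"]
    show "(F' n has_real_derivative F' (Suc n) t) (at t)"
      unfolding F'_def by simp
  next
    have "uminus ` {-s..s} = {-s..s}" by auto
    then show "continuous_on {-s..s} (\<lambda>t. - \<phi> (- t))"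
      by (intro continuous_on_minus continuous_on_compose2[OF cont]) (auto intro: continuous_intros)
    show "mono_on {-s..s} (\<lambda>t. - \<phi> (- t))"
      by (rule mono_onI) (use mono in \<open>auto simp: mono_on_def\<close>)
  qed (use False \<phi>0 m K s sq bd in \<open>auto simp: F'_def abs_mult power_abs\<close>)
  then show ?thesis by simp
qed

section \<open>The Gauss curvature of a graph\<close>

lemma bounded_linear_entry: "bounded_linear (\<lambda>d2g::real^'n::finite^'m::finite. d2g $ i $ j)"
  by (intro bounded_linear_compose[OF bounded_linear_vec_nth] bounded_linear_vec_nth)

lemma nonneg_second_derivative_at_minimum:
  fixes \<phi> \<phi>' :: "real \<Rightarrow> real"
  assumes d: "d > 0" and der: "\<And>t. \<bar>t\<bar> < d \<Longrightarrow> (\<phi> has_real_derivative \<phi>' t) (at t)"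
    and der2: "(\<phi>' has_real_derivative D) (at 0)"
    and min: "\<And>t. \<bar>t\<bar> < d \<Longrightarrow> \<phi> 0 \<le> \<phi> t"
  shows "D \<ge> 0"
proof (rule ccontr)
  assume "\<not> D \<ge> 0"
  then obtain d' where d': "d' > 0" "\<And>h. h > 0 \<Longrightarrow> h < d' \<Longrightarrow> \<phi>' h < \<phi>' 0"
    using has_real_derivative_neg_dec_right[OF der2] by auto
  have z: "\<phi>' 0 = 0"
    by (rule DERIV_local_min[OF der d]) (use d min in auto)
  define h where "h = min (d / 2) (d' / 2)"
  have h: "0 < h" "h < d" "h < d'" using d d' by (auto simp: h_def)
  obtain t where t: "0 < t" "t < h" "\<phi> h - \<phi> 0 = (h - 0) * \<phi>' t"
    using MVT2[OF h(1), of \<phi> \<phi>'] der h by force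
  then have "\<phi> h - \<phi> 0 < 0" using d'(2)[of t] h z by (simp add: mult_pos_neg)
  then show False using min[of h] h by simp
qed

lemma injective_derivative_isolates:
  fixes f :: "'a::euclidean_space \<Rightarrow> 'b::euclidean_space"
  assumes f: "(f has_derivative f') (at p)" and inj: "\<And>h. f' h = 0 \<Longrightarrow> h = 0"
  shows "\<exists>d>0. \<forall>z. norm (z - p) < d \<and> f z = f p \<longrightarrow> z = p"
proof -
  have lin: "linear f'" using f has_derivative_linear by blast
  then have "inj f'" using inj linear_injective_0 by blast
  then obtain B where B: "B > 0" "\<And>h. B * norm h \<le> norm (f' h)"
    using linear_inj_bounded_below_pos[OF lin] by blast
  obtain d where d: "d > 0" "\<And>y. norm (y - p) < d \<Longrightarrow> norm (f y - f p - f' (y - p)) \<le> (B / 2) * norm (y - p)"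
    using f B(1) unfolding has_derivative_at_alt by (meson half_gt_zero)
  have "z = p" if "norm (z - p) < d" "f z = f p" for z
  proof -
    have "B * norm (z - p) \<le> (B / 2) * norm (z - p)"
      using d(2)[OF that(1)] B(2)[of "z - p"] that(2) by (simp add: order_trans)
    then have "B * norm (z - p) \<le> 0" by simp
    then show ?thesis using B(1) by (simp add: mult_le_0_iff)
  qed
  then show ?thesis using d(1) by blast
qed

definition kron :: "'n \<Rightarrow> 'n \<Rightarrow> real" where "kron i j = (if i = j then 1 else 0)"

text \<open>
  In the coordinates of a graph the metric is \<open>I + \<nabla>u \<otimes> \<nabla>u\<close>, so its smoothness is that of all
  products of two first derivatives of \<open>u\<close>; about \<open>u\<close> itself only continuity of the gradient
  is known.
\<close>

locale graph_metric =
  fixes r :: real and g :: "real^2 \<Rightarrow> real^2^2" and u :: "real^2 \<Rightarrow> real" and v :: "2 \<Rightarrow> real^2 \<Rightarrow> real"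
  assumes g_C4: "Ck_on 4 g (ball 0 r)"
    and g_eq: "p \<in> ball 0 r \<Longrightarrow> g p $ i $ j = kron i j + v i p * v j p"
    and v_cont: "continuous_on (ball 0 r) (v i)"
    and u_diff: "p \<in> ball 0 r \<Longrightarrow> u differentiable (at p)"
    and v_grad: "p \<in> ball 0 r \<Longrightarrow> partial i u p = v i p"
begin

abbreviation S where "S \<equiv> ball (0::real^2) r"

definition crit where "crit = {p \<in> S. \<forall>i. v i p = 0}"

lemma crit_sub: "crit \<subseteq> S" by (auto simp: crit_def)

definition gdet where "gdet p = 1 + (v 1 p)\<^sup>2 + (v 2 p)\<^sup>2"

lemma gdet_pos: "gdet p > 0" unfolding gdet_def by (simp add: add_pos_nonneg)

lemma g_entry_C4: "Ck_on 4 (\<lambda>q. g q $ i $ j) S"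
  by (rule Ck_on_bounded_linear[OF open_ball bounded_linear_entry g_C4])

lemma g_diff: "p \<in> S \<Longrightarrow> g differentiable (at p)"
  and dg_diff: "p \<in> S \<Longrightarrow> partial i g differentiable (at p)"
  using g_C4 by (auto simp: eval_nat_numeral)

lemma partial_g_entry: "p \<in> S \<Longrightarrow> partial k (\<lambda>q. g q $ i $ j) p = partial k g p $ i $ j"
  by (rule partial_bounded_linear[OF bounded_linear_entry g_diff])

lemma det_g: "p \<in> S \<Longrightarrow> det (g p) = gdet p"
  by (simp add: det_2 g_eq kron_def gdet_def power2_eq_square algebra_simps)

lemma open_nonzero: "open {p \<in> S. v j p \<noteq> 0}"
  using continuous_open_preimage[OF v_cont[of j] open_ball, of "- {0}"]
  by (simp add: open_Compl vimage_def Int_def)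

lemma off_crit: "S - crit = {p \<in> S. v 1 p \<noteq> 0} \<union> {p \<in> S. v 2 p \<noteq> 0}"
  by (auto simp: crit_def forall_2)

lemma open_off_crit: "open (S - crit)"
  unfolding off_crit by (intro open_Un open_nonzero)

text \<open>
  Where one component of the gradient does not vanish, it is a continuous root of a \<open>C\<^sup>4\<close>
  function, and the other one is a quotient of \<open>C\<^sup>4\<close> functions.
\<close>

lemma v_C4_off_crit: "Ck_on 4 (v i) (S - crit)"
proof -
  have "Ck_on 4 (v i) {p \<in> S. v j p \<noteq> 0}" for i j
  proof -
    let ?U = "{p \<in> S. v j p \<noteq> 0}"
    have sub: "?U \<subseteq> S" by auto
    have g': "Ck_on 4 (\<lambda>q. g q $ i $ j + - kron i j) ?U" for i
      by (intro Ck_on_add Ck_on_const open_nonzero Ck_on_subset[OF g_entry_C4 sub])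
    have j: "Ck_on 4 (v j) ?U"
      by (rule Ck_on_continuous_root[OF open_nonzero continuous_on_subset[OF v_cont sub] _ _ g'[of j]])
        (auto simp: g_eq power2_eq_square)
    have inv: "Ck_on 4 (\<lambda>q. inverse (v j q)) ?U"
      by (rule Ck_on_inverse[OF open_nonzero j]) auto
    show ?thesis
      by (rule Ck_on_cong[OF open_nonzero _ Ck_on_mult[OF open_nonzero g'[of i] inv]])
        (auto simp: g_eq)
  qed
  then show ?thesis unfolding off_crit by (intro Ck_on_Un open_nonzero)
qed

definition hess where "hess i j = partial j (v i)"
definition third where "third i j k = partial k (hess i j)"

lemma v_diff: "p \<in> S - crit \<Longrightarrow> v i differentiable (at p)"
  and hess_C3: "Ck_on 3 (hess i j) (S - crit)"
  using v_C4_off_crit[of i] by (auto simp: eval_nat_numeral hess_def)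

lemma hess_diff: "p \<in> S - crit \<Longrightarrow> hess i j differentiable (at p)"
  using hess_C3[of i j] by (auto simp: eval_nat_numeral)

lemma hess_sym: "p \<in> S - crit \<Longrightarrow> hess i j p = hess j i p"
proof -
  assume p: "p \<in> S - crit"
  have pS: "p \<in> S" using p by simp
  have d: "partial i u differentiable (at p)" for i
    by (rule differentiable_cong_open[OF open_ball pS _ v_diff[OF p]]) (simp add: v_grad)
  have "hess i j p = partial j (partial i u) p" for i j
    unfolding hess_def by (rule partial_cong[OF open_ball pS]) (simp add: v_grad)
  then show ?thesis using partial_commute[OF open_ball pS u_diff d] by simp
qed

lemma third_sym12: "p \<in> S - crit \<Longrightarrow> third i j k p = third j i k p"
  unfolding third_def by (rule partial_cong[OF open_off_crit]) (auto intro: hess_sym)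

lemma third_sym23: "p \<in> S - crit \<Longrightarrow> third i j k p = third i k j p"
  unfolding third_def hess_def
  by (rule partial_commute[OF open_off_crit _ v_diff]) (auto simp: hess_def[symmetric] intro: hess_diff)

lemma partial_g_off_crit:
  assumes p: "p \<in> S - crit"
  shows "partial k (\<lambda>q. g q $ i $ j) p = v i p * hess j k p + hess i k p * v j p"
proof -
  have "partial k (\<lambda>q. g q $ i $ j) p = partial k (\<lambda>q. kron i j + v i q * v j q) p"
    by (rule partial_cong[OF open_off_crit p]) (simp add: g_eq)
  also have "\<dots> = v i p * hess j k p + hess i k p * v j p"
    using v_diff[OF p] by (simp add: partial_add partial_mult hess_def)
  finally show ?thesis .
qed

text \<open>The rank-one update formula for the inverse of \<open>I + \<nabla>u \<otimes> \<nabla>u\<close>.\<close>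

lemma matrix_inv_g:
  assumes p: "p \<in> S"
  shows "matrix_inv (g p) $ k $ l = kron k l - v k p * v l p / gdet p"
proof -
  have "invertible (g p)" using det_g[OF p] gdet_pos[of p] by (simp add: invertible_det_nz)
  then have inv: "matrix_inv (g p) ** g p = mat 1"
    unfolding invertible_def matrix_inv_def by (rule someI2_ex) simp
  define B :: "real^2^2" where "B = (\<chi> k l. kron k l - v k p * v l p / gdet p)"
  have "(g p ** B) $ i $ j = mat 1 $ i $ j" for i j
  proof -
    have "gdet p * (g p ** B) $ i $ j = gdet p * mat 1 $ i $ j"
      using exhaust_2[of i] exhaust_2[of j] gdet_pos[of p]
      by (auto simp: matrix_matrix_mult_def sum_2 B_def g_eq[OF p] kron_def mat_def field_simps)
        (auto simp: gdet_def power2_eq_square algebra_simps)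
    then show ?thesis using gdet_pos[of p] by simp
  qed
  then have "g p ** B = mat 1" by (simp add: vec_eq_iff)
  then have "matrix_inv (g p) = B"
    using inv by (metis matrix_mul_assoc matrix_mul_lid matrix_mul_rid)
  then show ?thesis by (simp add: B_def)
qed

text \<open>
  Off the critical points \<open>u\<close> is smooth enough to differentiate the metric term by term, and
  the Christoffel symbols are
  \<open>\<partial>\<^sub>k u \<partial>\<^sub>i\<^sub>j u / det g\<close>; in the curvature the third derivatives of \<open>u\<close> cancel by
  symmetry, which leaves \<open>det D\<^sup>2u / (1 + \<bar>\<nabla>u\<bar>\<^sup>2)\<^sup>2\<close>.
\<close>

lemma christoffel_off_crit:
  assumes p: "p \<in> S - crit"
  shows "christoffel g k i j p = v k p * (hess i j p * inverse (gdet p))"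
proof -
  have pS: "p \<in> S" using p by simp
  have "partial i (\<lambda>q. g q $ j $ l) p + partial j (\<lambda>q. g q $ i $ l) p - partial l (\<lambda>q. g q $ i $ j) p
      = 2 * (v l p * hess i j p)" for l
    unfolding partial_g_off_crit[OF p] hess_sym[OF p, of l i] hess_sym[OF p, of l j] hess_sym[OF p, of j i]
    by (simp add: algebra_simps)
  then have "christoffel g k i j p = (\<Sum>l\<in>UNIV. (kron k l - v k p * v l p / gdet p) * (v l p * hess i j p))"
    unfolding christoffel_def matrix_inv_g[OF pS] sum_distrib_left by simp
  also have "\<dots> = v k p * (hess i j p * inverse (gdet p))"
    using exhaust_2[of k] gdet_pos[of p]
    by (auto simp: sum_2 kron_def field_simps) (auto simp: gdet_def power2_eq_square algebra_simps)
  finally show ?thesis .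
qed

lemma partial_christoffel_off_crit:
  assumes p: "p \<in> S - crit"
  shows "partial m (christoffel g k i j) p =
    hess k m p * hess i j p / gdet p + v k p * third i j m p / gdet p
      - v k p * hess i j p * (2 * (v 1 p * hess 1 m p + v 2 p * hess 2 m p)) / (gdet p)\<^sup>2"
proof -
  have gdet: "partial m gdet p = 2 * (v 1 p * hess 1 m p + v 2 p * hess 2 m p)" "gdet differentiable (at p)"
    unfolding gdet_def[abs_def] power2_eq_square using v_diff[OF p]
    by (auto simp: partial_add partial_mult hess_def intro!: differentiable_add differentiable_mult)
  have "partial m (christoffel g k i j) p = partial m (\<lambda>q. v k q * (hess i j q * inverse (gdet q))) p"
    by (rule partial_cong[OF open_off_crit p]) (rule christoffel_off_crit)
  also have "\<dots> = v k p * (hess i j p * (- (inverse (gdet p) * partial m gdet p * inverse (gdet p)))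
      + third i j m p * inverse (gdet p)) + hess k m p * (hess i j p * inverse (gdet p))"
    using v_diff[OF p] hess_diff[OF p] gdet(2) gdet_pos[of p]
    by (simp add: partial_mult partial_inverse hess_def[symmetric] third_def differentiable_mult differentiable_inverse
        del: mult_minus_right)
  also have "\<dots> = hess k m p * hess i j p / gdet p + v k p * third i j m p / gdet p
      - v k p * hess i j p * (2 * (v 1 p * hess 1 m p + v 2 p * hess 2 m p)) / (gdet p)\<^sup>2"
    unfolding gdet(1) by (simp add: divide_inverse power2_eq_square algebra_simps)
  finally show ?thesis .
qed

lemma gauss_curvature_off_crit:
  assumes p: "p \<in> S - crit"
  shows "gauss_curvature g p = (hess 1 1 p * hess 2 2 p - (hess 1 2 p)\<^sup>2) / (gdet p)\<^sup>2"
proof -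
  have pS: "p \<in> S" using p by simp
  define a b c x y w where "a = hess 1 1 p" and "b = hess 1 2 p" and "c = hess 2 2 p"
    and "x = v 1 p" and "y = v 2 p" and "w = gdet p"
  note abc = a_def[symmetric] b_def[symmetric] c_def[symmetric] x_def[symmetric] y_def[symmetric]
    w_def[symmetric]
  have b': "hess 2 1 p = b" using hess_sym[OF p] b_def by simp
  have w: "w > 0" "w = 1 + x\<^sup>2 + y\<^sup>2" using gdet_pos[of p] by (auto simp: w_def gdet_def x_def y_def)
  have third: "third 2 2 1 p = third 1 2 2 p" using third_sym23[OF p] third_sym12[OF p] by metis
  have R: "riemann g l 2 1 2 p = (hess l 1 p * c - hess l 2 p * b) / w - v l p * (x * (a * c - b\<^sup>2)) / w\<^sup>2" for l
    unfolding riemann_def partial_christoffel_off_crit[OF p] christoffel_off_crit[OF p] sum_2 third b' abc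
    using w(1) by (simp add: field_simps power2_eq_square)
  have "(\<Sum>l\<in>UNIV. g p $ 1 $ l * riemann g l 2 1 2 p) =
      (1 + x\<^sup>2) * ((a * c - b\<^sup>2) / w - x * (x * (a * c - b\<^sup>2)) / w\<^sup>2)
        + x * y * (0 - y * (x * (a * c - b\<^sup>2)) / w\<^sup>2)"
    unfolding R sum_2 g_eq[OF pS] b' abc by (simp add: kron_def power2_eq_square algebra_simps)
  also have "\<dots> = (a * c - b\<^sup>2) * ((1 + x\<^sup>2) * w - x\<^sup>2 * (1 + x\<^sup>2 + y\<^sup>2)) / w\<^sup>2"
    using w(1) by (simp add: field_simps power2_eq_square)
  also have "\<dots> = (a * c - b\<^sup>2) / w"
    unfolding w(2)[symmetric] using w(1) by (simp add: field_simps power2_eq_square)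
  finally show ?thesis
    unfolding gauss_curvature_def det_g[OF pS] abc by (simp add: power2_eq_square)
qed

text \<open>
  At a critical point each \<open>g(e, e)\<close> attains its minimum \<open>\<bar>e\<bar>\<^sup>2\<close>, so its derivatives vanish;
  polarization gives the mixed entry.
\<close>

lemma partial_g_on_crit:
  assumes p: "p \<in> crit"
  shows "partial k g p = 0"
proof -
  have pS: "p \<in> S" using p crit_sub by auto
  have min: "e \<bullet> (partial k g p *v e) = 0" for e
  proof -
    have bl: "bounded_linear (\<lambda>d2g::real^2^2. e \<bullet> (d2g *v e))"
      unfolding linear_conv_bounded_linear[symmetric]
      by (rule linearI) (auto simp: matrix_vector_mult_add_rdistrib inner_add_right scaleR_matrix_vector_assoc[symmetric])
    let ?f = "\<lambda>q. e \<bullet> (g q *v e)"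
    have d: "?f differentiable (at p)" by (rule differentiable_bounded_linear[OF bl g_diff[OF pS]])
    have f: "?f q = e \<bullet> e + (e $ 1 * v 1 q + e $ 2 * v 2 q)\<^sup>2" if "q \<in> S" for q
      by (simp add: matrix_vector_mult_def inner_vec_def sum_2 g_eq[OF that] kron_def power2_eq_square algebra_simps)
    have fp: "?f p = e \<bullet> e" using f[OF pS] p by (simp add: crit_def)
    have "?f p \<le> ?f q" if "q \<in> S" for q unfolding fp f[OF that] by simp
    then have "frechet_derivative ?f (at p) = (\<lambda>h. 0)"
      using differential_zero_maxmin[OF pS open_ball] d frechet_derivative_works by blast
    then show ?thesis
      using partial_bounded_linear[OF bl g_diff[OF pS], of k] by (simp add: partial_def)
  qed
  have sym: "partial k g p $ 1 $ 2 = partial k g p $ 2 $ 1"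
    unfolding partial_g_entry[OF pS, symmetric]
    by (rule partial_cong[OF open_ball pS]) (auto simp: g_eq kron_def)
  have "partial k g p $ i $ j = 0" for i j
    using min[of "axis 1 1"] min[of "axis 2 1"] min[of "axis 1 1 + axis 2 1"] sym exhaust_2[of i] exhaust_2[of j]
    by (auto simp: matrix_vector_mult_def inner_vec_def sum_2 axis_def)
  then show ?thesis by (simp add: vec_eq_iff)
qed

definition d2g where "d2g p i j = partial i (partial j g) p"

lemma d2g_entry:
  assumes p: "p \<in> S"
  shows "partial i (partial j (\<lambda>q. g q $ k $ l)) p = d2g p i j $ k $ l"
proof -
  have "partial i (partial j (\<lambda>q. g q $ k $ l)) p = partial i (\<lambda>q. partial j g q $ k $ l) p"
    by (rule partial_cong[OF open_ball p]) (rule partial_g_entry)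
  also have "\<dots> = d2g p i j $ k $ l"
    unfolding d2g_def by (rule partial_bounded_linear[OF bounded_linear_entry dg_diff[OF p]])
  finally show ?thesis .
qed

lemma d2g_sym:
  assumes p: "p \<in> S"
  shows "d2g p i j = d2g p j i" "d2g p i j $ k $ l = d2g p i j $ l $ k"
proof -
  have d: "partial m (\<lambda>q. g q $ k $ l) differentiable (at q)" if "q \<in> S" for m k l q
    using g_entry_C4[of k l] that by (auto simp: eval_nat_numeral)
  have "d2g p i j $ k $ l = d2g p j i $ k $ l" for k l
    unfolding d2g_entry[OF p, symmetric]
    by (rule partial_commute[OF open_ball p _ d[OF p]])
      (use g_entry_C4[of k l] in \<open>auto simp: eval_nat_numeral\<close>)
  then show "d2g p i j = d2g p j i" by (simp add: vec_eq_iff)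
  show "d2g p i j $ k $ l = d2g p i j $ l $ k"
    unfolding d2g_entry[OF p, symmetric]
    by (intro partial_cong[OF open_ball p] partial_cong[where S = S]) (auto simp: g_eq kron_def)
qed

text \<open>
  Since the lowered Christoffel symbols vanish at a critical point, their derivatives there do not
  see the derivative of the inverse metric.
\<close>

lemma gauss_curvature_on_crit:
  assumes p: "p \<in> crit"
  shows "gauss_curvature g p = (2 * d2g p 1 2 $ 1 $ 2 - d2g p 1 1 $ 2 $ 2 - d2g p 2 2 $ 1 $ 1) / 2"
proof -
  have pS: "p \<in> S" using p crit_sub by auto
  have v0: "v i p = 0" for i using p by (simp add: crit_def)
  let ?N = "\<lambda>i j l q. partial i (\<lambda>q. g q $ j $ l) q + partial j (\<lambda>q. g q $ i $ l) q - partial l (\<lambda>q. g q $ i $ j) q"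
  have d: "partial m (\<lambda>q. g q $ k $ l) differentiable (at p)" for m k l
    using g_entry_C4[of k l] pS by (auto simp: eval_nat_numeral)
  have N0: "?N i j l p = 0" for i j l
    using partial_g_on_crit[OF p] by (simp add: partial_g_entry[OF pS])
  have Nd: "?N i j l differentiable (at p)" for i j l
    by (intro differentiable_add differentiable_diff d)
  have Np: "partial m (?N i j l) p = d2g p m i $ j $ l + d2g p m j $ i $ l - d2g p m l $ i $ j" for m i j l
    using d by (simp add: partial_add partial_diff differentiable_add d2g_entry[OF pS])
  let ?J = "\<lambda>k l q. matrix_inv (g q) $ k $ l"
  have Jd: "?J k l differentiable (at p)" for k l
  proof (rule differentiable_cong_open[OF open_ball pS])
    let ?h = "\<lambda>q. kron k l - (g q $ k $ l - kron k l) * inverse (g q $ 1 $ 1 + g q $ 2 $ 2 - 1)"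
    show "?h q = ?J k l q" if "q \<in> S" for q
      using that by (simp add: matrix_inv_g g_eq kron_def gdet_def power2_eq_square divide_inverse add.assoc)
    have gd: "(\<lambda>q. g q $ k $ l) differentiable (at p)" for k l
      using g_entry_C4[of k l] pS by (auto simp: eval_nat_numeral)
    show "?h differentiable (at p)"
      using pS by (intro differentiable_diff differentiable_mult differentiable_inverse differentiable_add gd differentiable_const)
        (simp add: g_eq kron_def v0)
  qed
  have Jp: "?J k l p = kron k l" for k l using matrix_inv_g[OF pS] v0 by simp
  have \<Gamma>: "christoffel g k i j = (\<lambda>q. (1/2) * (?J k 1 q * ?N i j 1 q + ?J k 2 q * ?N i j 2 q))" for k i j
    by (rule ext) (simp add: christoffel_def sum_2)
  have \<Gamma>0: "christoffel g k i j p = 0" for k i j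
    unfolding christoffel_def N0 by simp
  have \<Gamma>d: "partial m (christoffel g k i j) p = (1/2) * (d2g p m i $ j $ k + d2g p m j $ i $ k - d2g p m k $ i $ j)"
    for m k i j
  proof -
    have "partial m (christoffel g k i j) p =
       (1/2) * (?J k 1 p * partial m (?N i j 1) p + ?J k 2 p * partial m (?N i j 2) p)"
      unfolding \<Gamma>
      by (subst partial_mult[OF differentiable_const], intro differentiable_add differentiable_mult Jd Nd)
        (simp add: partial_add[OF differentiable_mult[OF Jd Nd] differentiable_mult[OF Jd Nd]]
          partial_mult[OF Jd Nd] N0)
    then show ?thesis unfolding Np Jp using exhaust_2[of k] by (auto simp: kron_def)
  qed
  have "gauss_curvature g p = partial 1 (christoffel g 1 2 2) p - partial 2 (christoffel g 1 1 2) p"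
    unfolding gauss_curvature_def det_g[OF pS] riemann_def \<Gamma>0 sum_2
    by (simp add: g_eq[OF pS] v0 kron_def gdet_def)
  also have "\<dots> = (2 * d2g p 1 2 $ 1 $ 2 - d2g p 1 1 $ 2 $ 2 - d2g p 2 2 $ 1 $ 1) / 2"
    unfolding \<Gamma>d using d2g_sym[OF pS] by (simp add: d2g_sym(1)[OF pS, of 2 1] d2g_sym(2)[OF pS, of _ _ 2 1])
  finally show ?thesis .
qed

end

section \<open>The only critical point\<close>

definition dir :: "real^2 \<Rightarrow> (real^2 \<Rightarrow> real) \<Rightarrow> real^2 \<Rightarrow> real" where
  "dir e f q = (\<Sum>i\<in>UNIV. e $ i * partial i f q)"

lemma dir_cong:
  assumes "open A" "p \<in> A" "\<And>q. q \<in> A \<Longrightarrow> f q = h q"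
  shows "dir e f p = dir e h p"
  unfolding dir_def using partial_cong[OF assms] by simp

lemma dir_add:
  assumes "f differentiable (at p)" "h differentiable (at p)"
  shows "dir e (\<lambda>q. f q + h q) p = dir e f p + dir e h p"
  unfolding dir_def partial_add[OF assms] by (simp add: distrib_left sum.distrib)

lemma dir_mult:
  assumes "f differentiable (at p)" "h differentiable (at p)"
  shows "dir e (\<lambda>q. f q * h q) p = f p * dir e h p + dir e f p * h p"
  unfolding dir_def partial_mult[OF assms] by (simp add: algebra_simps sum_2)

lemma Ck_on_dir:
  assumes "open A" "Ck_on (Suc k) f A"
  shows "Ck_on k (dir e f) A"
proof -
  have "Ck_on k (\<lambda>q. e $ 1 * partial 1 f q + e $ 2 * partial 2 f q) A"
    using assms(2) by (intro Ck_on_add Ck_on_mult Ck_on_const assms(1)) auto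
  then show ?thesis by (simp add: dir_def[abs_def] sum_2)
qed

lemma Ck_on_dir_iterate:
  assumes "open A" "Ck_on (n + k) f A"
  shows "Ck_on k ((dir e ^^ n) f) A"
  using assms(2)
proof (induction n arbitrary: k)
  case (Suc n)
  have "Ck_on (n + Suc k) f A" using Suc.prems by (simp only: add_Suc add_Suc_right)
  then have "Ck_on (Suc k) ((dir e ^^ n) f) A" by (rule Suc.IH)
  then show ?case using Ck_on_dir[OF assms(1)] by (simp del: Ck_on.simps)
qed simp

text \<open>
  The letters \<open>a, b, c\<close> stand for the Hessians of \<open>g\<^sub>1\<^sub>1, g\<^sub>1\<^sub>2, g\<^sub>2\<^sub>2\<close> at a critical point. A
  direction \<open>h\<close> annihilated by all of them makes each a multiple of \<open>n \<otimes> n\<close> with \<open>n\<close>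
  orthogonal to \<open>h\<close>; then twice the curvature is a nonpositive multiple of the second derivative
  in direction \<open>n\<close> of \<open>g(h, h)\<close>, the quantity in the last assumption.
\<close>

lemma annihilated_hessians_nonpositive:
  fixes h1 h2 a11 a12 a22 b11 b12 b22 c11 c12 c22 :: real
  assumes a: "h1 * a11 + h2 * a12 = 0" "h1 * a12 + h2 * a22 = 0"
    and b: "h1 * b11 + h2 * b12 = 0" "h1 * b12 + h2 * b22 = 0"
    and c: "h1 * c11 + h2 * c12 = 0" "h1 * c12 + h2 * c22 = 0"
    and h: "h1 \<noteq> 0 \<or> h2 \<noteq> 0"
    and psd: "h1\<^sup>2 * (h2\<^sup>2 * a11 - 2 * h1 * h2 * a12 + h1\<^sup>2 * a22)
      + 2 * h1 * h2 * (h2\<^sup>2 * b11 - 2 * h1 * h2 * b12 + h1\<^sup>2 * b22)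
      + h2\<^sup>2 * (h2\<^sup>2 * c11 - 2 * h1 * h2 * c12 + h1\<^sup>2 * c22) \<ge> 0"
  shows "2 * b12 - c11 - a22 \<le> 0"
proof -
  define N where "N = h1\<^sup>2 + h2\<^sup>2"
  have N: "N > 0" unfolding N_def using h by (simp add: sum_power2_gt_zero_iff)
  have form: "h2\<^sup>2 * m11 - 2 * h1 * h2 * m12 + h1\<^sup>2 * m22 = N * (m11 + m22)"
    and e11: "N * m11 = h2\<^sup>2 * (m11 + m22)" and e12: "N * m12 = - (h1 * h2 * (m11 + m22))"
    and e22: "N * m22 = h1\<^sup>2 * (m11 + m22)"
    if m: "h1 * m11 + h2 * m12 = 0" "h1 * m12 + h2 * m22 = 0" for m11 m12 m22
    using m unfolding N_def by algebra+
  \<comment> \<open>A rank-one symmetric matrix with kernel \<open>h\<close> is its trace times \<open>n \<otimes> n / \<bar>n\<bar>\<^sup>2\<close>.\<close>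
  have "N * (N * (2 * b12 - c11 - a22)) = N * (2 * (N * b12) - N * c11 - N * a22)"
    by (simp add: algebra_simps)
  also have "\<dots> = - (h1\<^sup>2 * (N * (a11 + a22))
      + 2 * h1 * h2 * (N * (b11 + b22)) + h2\<^sup>2 * (N * (c11 + c22)))"
    unfolding e12[OF b] e11[OF c] e22[OF a] by (simp add: algebra_simps)
  also have "\<dots> \<le> 0" using psd unfolding form[OF a] form[OF b] form[OF c] by simp
  finally show ?thesis using N by (simp add: mult_le_0_iff)
qed

locale positively_curved_graph = graph_metric +
  assumes r_pos: "r > 0"
    and curv: "p \<in> ball 0 r - {0} \<Longrightarrow> gauss_curvature g p > 0"
    and v_zero: "v i 0 = 0"
begin

lemma bounded_linear_quadratic: "bounded_linear (\<lambda>d2g::real^2^2. e \<bullet> (d2g *v e))"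
  unfolding linear_conv_bounded_linear[symmetric]
  by (rule linearI)
    (auto simp: matrix_vector_mult_add_rdistrib inner_add_right scaleR_matrix_vector_assoc[symmetric])

definition slope where "slope e q = e $ 1 * v 1 q + e $ 2 * v 2 q"

lemma g_quadratic: "q \<in> S \<Longrightarrow> e \<bullet> (g q *v e) = e \<bullet> e + (slope e q)\<^sup>2"
  by (simp add: slope_def matrix_vector_mult_def inner_vec_def sum_2 g_eq kron_def power2_eq_square
      algebra_simps)

text \<open>The function \<open>g(e, e) - \<bar>e\<bar>\<^sup>2\<close> is a square, so a critical point is a minimum of it.\<close>

lemma hessian_psd_on_crit:
  assumes p: "p \<in> crit"
  shows "0 \<le> (\<Sum>i\<in>UNIV. n $ i * (\<Sum>j\<in>UNIV. n $ j * (e \<bullet> (d2g p i j *v e))))"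
proof -
  have pS: "p \<in> S" using p crit_sub by auto
  let ?f = "\<lambda>q. e \<bullet> (g q *v e)"
  have pf: "partial j ?f q = e \<bullet> (partial j g q *v e)" if "q \<in> S" for j q
    by (rule partial_bounded_linear[OF bounded_linear_quadratic g_diff[OF that]])
  have df: "?f differentiable (at q)" if "q \<in> S" for q
    by (rule differentiable_bounded_linear[OF bounded_linear_quadratic g_diff[OF that]])
  have d1: "(\<lambda>q. e \<bullet> (partial j g q *v e)) differentiable (at p)" for j
    by (rule differentiable_bounded_linear[OF bounded_linear_quadratic dg_diff[OF pS]])
  obtain d where d: "d > 0" "ball p d \<subseteq> S" using pS open_ball open_contains_ball by blast
  define d' where "d' = d / (norm n + 1)"
  have n1: "norm n + 1 > 0" by (simp add: add_nonneg_pos)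
  have d': "d' > 0" using d n1 by (simp add: d'_def)
  have inS: "p + t *\<^sub>R n \<in> S" if "\<bar>t\<bar> < d'" for t
  proof -
    have "\<bar>t\<bar> * (norm n + 1) < d" using that n1 by (simp add: d'_def pos_less_divide_eq)
    then have "\<bar>t\<bar> * norm n < d" by (simp add: algebra_simps)
    then have "p + t *\<^sub>R n \<in> ball p d" by (simp add: dist_norm)
    then show ?thesis using d(2) by blast
  qed
  show ?thesis
  proof (rule nonneg_second_derivative_at_minimum[OF d'])
    fix t assume t: "\<bar>t\<bar> < d'"
    show "((\<lambda>t. ?f (p + t *\<^sub>R n)) has_real_derivative
        (\<Sum>j\<in>UNIV. n $ j * (e \<bullet> (partial j g (p + t *\<^sub>R n) *v e)))) (at t)"
      using has_real_derivative_line[OF df[OF inS[OF t]]] unfolding pf[OF inS[OF t]] .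
    show "?f (p + 0 *\<^sub>R n) \<le> ?f (p + t *\<^sub>R n)"
      using g_quadratic[OF inS[OF t], of e] g_quadratic[OF pS, of e] p by (simp add: slope_def crit_def)
  next
    have "((\<lambda>t. e \<bullet> (partial j g (p + t *\<^sub>R n) *v e)) has_real_derivative
        (\<Sum>i\<in>UNIV. n $ i * (e \<bullet> (d2g p i j *v e)))) (at 0)" for j
      using has_real_derivative_line[of "\<lambda>q. e \<bullet> (partial j g q *v e)" p 0 n] d1[of j]
        partial_bounded_linear[OF bounded_linear_quadratic dg_diff[OF pS], of _ e j]
      by (simp add: d2g_def)
    then have "((\<lambda>t. \<Sum>j\<in>UNIV. n $ j * (e \<bullet> (partial j g (p + t *\<^sub>R n) *v e))) has_real_derivative
        (\<Sum>j\<in>UNIV. n $ j * (\<Sum>i\<in>UNIV. n $ i * (e \<bullet> (d2g p i j *v e))))) (at 0)"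
      by (intro DERIV_sum DERIV_cmult)
    then show "((\<lambda>t. \<Sum>j\<in>UNIV. n $ j * (e \<bullet> (partial j g (p + t *\<^sub>R n) *v e))) has_real_derivative
        (\<Sum>i\<in>UNIV. n $ i * (\<Sum>j\<in>UNIV. n $ j * (e \<bullet> (d2g p i j *v e))))) (at 0)"
      using d2g_sym(1)[OF pS, of 1 2] by (simp add: sum_2)
  qed
qed

text \<open>
  The first derivatives of \<open>g\<close> vanish at every critical point. Positive curvature makes the
  derivative of \<open>Dg\<close> injective, and an injective derivative keeps other zeros away.
\<close>

lemma crit_isolated:
  assumes p: "p \<in> crit" "p \<noteq> 0"
  shows "\<exists>d>0. \<forall>z\<in>crit. norm (z - p) < d \<longrightarrow> z = p"
proof -
  have pS: "p \<in> S" using p crit_sub by auto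
  let ?f = "\<lambda>z. (partial 1 g z, partial 2 g z)"
  let ?f' = "\<lambda>h. (\<Sum>i\<in>UNIV. h $ i *\<^sub>R d2g p i 1, \<Sum>i\<in>UNIV. h $ i *\<^sub>R d2g p i 2)"
  have der: "(?f has_derivative ?f') (at p)"
    unfolding d2g_def by (intro has_derivative_Pair has_derivative_partials dg_diff pS)
  have inj: "h = 0" if 0: "?f' h = 0" for h :: "real^2"
  proof (rule ccontr)
    assume h: "h \<noteq> 0"
    have ann: "h $ 1 * d2g p 1 j $ k $ l + h $ 2 * d2g p 2 j $ k $ l = 0" for j k l
    proof -
      have "(\<Sum>i\<in>UNIV. h $ i *\<^sub>R d2g p i j) = 0" using 0 exhaust_2[of j] by (auto simp: zero_prod_def)
      then have "(\<Sum>i\<in>UNIV. h $ i *\<^sub>R d2g p i j) $ k $ l = 0" by simp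
      then show ?thesis by (simp add: sum_2)
    qed
    have s: "d2g p 2 1 = d2g p 1 2" "d2g p i j $ 2 $ 1 = d2g p i j $ 1 $ 2" for i j
      using d2g_sym[OF pS] by blast+
    define n :: "real^2" where "n = vector [- h $ 2, h $ 1]"
    have "2 * d2g p 1 2 $ 1 $ 2 - d2g p 1 1 $ 2 $ 2 - d2g p 2 2 $ 1 $ 1 \<le> 0"
    proof (rule annihilated_hessians_nonpositive[where ?h1.0 = "h $ 1" and ?h2.0 = "h $ 2"
          and ?a11.0 = "d2g p 1 1 $ 1 $ 1" and ?a12.0 = "d2g p 1 2 $ 1 $ 1" and ?a22.0 = "d2g p 2 2 $ 1 $ 1"
          and ?b11.0 = "d2g p 1 1 $ 1 $ 2" and ?b12.0 = "d2g p 1 2 $ 1 $ 2" and ?b22.0 = "d2g p 2 2 $ 1 $ 2"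
          and ?c11.0 = "d2g p 1 1 $ 2 $ 2" and ?c12.0 = "d2g p 1 2 $ 2 $ 2" and ?c22.0 = "d2g p 2 2 $ 2 $ 2"])
      show "h $ 1 \<noteq> 0 \<or> h $ 2 \<noteq> 0" using h by (auto simp: vec_eq_iff forall_2)
      show "0 \<le> (h $ 1)\<^sup>2 * ((h $ 2)\<^sup>2 * d2g p 1 1 $ 1 $ 1 - 2 * h $ 1 * h $ 2 * d2g p 1 2 $ 1 $ 1
            + (h $ 1)\<^sup>2 * d2g p 2 2 $ 1 $ 1)
          + 2 * h $ 1 * h $ 2 * ((h $ 2)\<^sup>2 * d2g p 1 1 $ 1 $ 2 - 2 * h $ 1 * h $ 2 * d2g p 1 2 $ 1 $ 2
            + (h $ 1)\<^sup>2 * d2g p 2 2 $ 1 $ 2)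
          + (h $ 2)\<^sup>2 * ((h $ 2)\<^sup>2 * d2g p 1 1 $ 2 $ 2 - 2 * h $ 1 * h $ 2 * d2g p 1 2 $ 2 $ 2
            + (h $ 1)\<^sup>2 * d2g p 2 2 $ 2 $ 2)"
        using hessian_psd_on_crit[OF p(1), of n h]
        by (simp add: sum_2 n_def matrix_vector_mult_def inner_vec_def s power2_eq_square algebra_simps)
    qed (use ann[of 1] ann[of 2] s in auto)
    then show False
      using curv[of p] p pS gauss_curvature_on_crit[OF p(1)] by simp
  qed
  obtain d where "d > 0" "\<forall>z. norm (z - p) < d \<and> ?f z = ?f p \<longrightarrow> z = p"
    using injective_derivative_isolates[OF der inj] by blast
  then show ?thesis using partial_g_on_crit p(1) by (intro exI[of _ d]) auto
qed

text \<open>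
  The set need not be discrete, since critical points might accumulate at the origin, where the
  curvature may vanish; but the rest of the disc is a countable union of compact sets, each with
  finitely many critical points.
\<close>

lemma countable_crit: "countable crit"
proof -
  have "(crit - {0}) sparse_in (S - {0})"
    unfolding sparse_in_def
  proof
    fix x assume x: "x \<in> S - {0}"
    have *: "\<not> y islimpt (crit - {0})" if B: "open B" "y \<in> B" "B \<inter> crit \<subseteq> {x}" for B y
    proof
      assume lim: "y islimpt (crit - {0})"
      have o: "open (B - ({x} - {y}))" by (intro open_Diff B(1) finite_imp_closed) auto
      have "y \<in> B - ({x} - {y})" using B(2) by simp
      from lim[unfolded islimpt_def, rule_format, OF this o]
      obtain z where "z \<in> crit" "z \<in> B" "z \<noteq> x" "z \<noteq> y" by auto
      then show False using B(3) by auto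
    qed
    show "\<exists>B. x \<in> B \<and> open B \<and> (\<forall>y\<in>B. \<not> y islimpt (crit - {0}))"
    proof (cases "x \<in> crit")
      case True
      then obtain d where d: "d > 0" "\<forall>z\<in>crit. norm (z - x) < d \<longrightarrow> z = x"
        using crit_isolated[of x] x by auto
      then have "ball x d \<inter> crit \<subseteq> {x}" by (auto simp: dist_norm norm_minus_commute)
      then show ?thesis using *[OF open_ball] d(1) by (intro exI[of _ "ball x d"]) auto
    next
      case False
      have "(S - crit) \<inter> crit \<subseteq> {x}" by blast
      then have "\<forall>y\<in>S - crit. \<not> y islimpt (crit - {0})" using *[OF open_off_crit] by blast
      moreover have "x \<in> S - crit" using x False by blast
      ultimately show ?thesis using open_off_crit by blast
    qed
  qed
  then have "countable ((S - {0}) \<inter> (crit - {0}))"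
    by (rule sparse_imp_countable[rotated]) (simp add: open_Diff)
  then have "countable (insert 0 ((S - {0}) \<inter> (crit - {0})))" by simp
  then show ?thesis by (rule countable_subset[rotated]) (use crit_sub in auto)
qed

lemma det_hess_pos:
  assumes "p \<in> S - crit" "p \<noteq> 0"
  shows "(hess 1 2 p)\<^sup>2 < hess 1 1 p * hess 2 2 p"
  using curv[of p] assms gauss_curvature_off_crit[OF assms(1)] gdet_pos[of p]
  by (auto simp: zero_less_divide_iff)

text \<open>
  Removing countably many points from the disc leaves it connected, so the definite form \<open>hess\<close> has
  the same sign everywhere.
\<close>

lemma hess_definite:
  obtains \<sigma> :: real where "\<sigma> = 1 \<or> \<sigma> = -1"
    "\<And>p (e :: real^2). p \<in> S - crit \<Longrightarrow> p \<noteq> 0 \<Longrightarrow> e \<noteq> 0 \<Longrightarrow>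
      0 < \<sigma> * ((e $ 1)\<^sup>2 * hess 1 1 p + 2 * e $ 1 * e $ 2 * hess 1 2 p + (e $ 2)\<^sup>2 * hess 2 2 p)"
proof -
  let ?U = "S - (crit \<union> {0})"
  have conn: "connected ?U"
    by (rule connected_open_diff_countable) (use countable_crit in \<open>auto intro: convex_connected\<close>)
  have cont: "continuous_on ?U (hess 1 1)"
    by (rule continuous_on_subset[OF Ck_on_continuous[OF hess_C3]]) auto
  have nz: "hess 1 1 p \<noteq> 0" if "p \<in> ?U" for p
    using det_hess_pos[of p] that by auto
  have conn': "connected (hess 1 1 ` ?U)" by (rule connected_continuous_image[OF cont conn])
  have "(\<forall>p\<in>?U. hess 1 1 p > 0) \<or> (\<forall>p\<in>?U. hess 1 1 p < 0)"
  proof (rule ccontr)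
    assume "\<not> ?thesis"
    then obtain p q where pq: "p \<in> ?U" "q \<in> ?U" "hess 1 1 p \<le> 0" "0 \<le> hess 1 1 q"
      by (metis linorder_not_less)
    then have "0 \<in> hess 1 1 ` ?U"
      using connectedD_interval[OF conn', of "hess 1 1 p" "hess 1 1 q" 0] by blast
    then obtain x where "x \<in> ?U" "hess 1 1 x = 0" by (metis imageE)
    then show False using nz by blast
  qed
  then obtain \<sigma> :: real where \<sigma>: "\<sigma> = 1 \<or> \<sigma> = -1" "\<And>p. p \<in> ?U \<Longrightarrow> \<sigma> * hess 1 1 p > 0"
    by (metis mult_1 mult_minus1 neg_0_less_iff_less)
  have "0 < \<sigma> * ((e $ 1)\<^sup>2 * hess 1 1 p + 2 * e $ 1 * e $ 2 * hess 1 2 p + (e $ 2)\<^sup>2 * hess 2 2 p)"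
    if p: "p \<in> S - crit" "p \<noteq> 0" and e: "e \<noteq> 0" for p and e :: "real^2"
  proof -
    define a b c where "a = hess 1 1 p" and "b = hess 1 2 p" and "c = hess 2 2 p"
    have a: "\<sigma> * a > 0" using \<sigma>(2)[of p] p by (simp add: a_def)
    have D: "a * c - b\<^sup>2 > 0" using det_hess_pos[OF p] by (simp add: a_def b_def c_def)
    have "0 < (a * e $ 1 + b * e $ 2)\<^sup>2 + (a * c - b\<^sup>2) * (e $ 2)\<^sup>2"
    proof (cases "e $ 2 = 0")
      case True
      then have "e $ 1 \<noteq> 0" using e by (auto simp: vec_eq_iff forall_2)
      then show ?thesis using True a by auto
    next
      case False
      then show ?thesis using D by (simp add: add_nonneg_pos)
    qed
    also have "\<dots> = (\<sigma> * a) * (\<sigma> * ((e $ 1)\<^sup>2 * a + 2 * e $ 1 * e $ 2 * b + (e $ 2)\<^sup>2 * c))"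
      using \<sigma>(1) by (auto simp: power2_eq_square algebra_simps)
    finally show ?thesis using a unfolding a_def b_def c_def by (simp add: zero_less_mult_iff)
  qed
  then show thesis using that \<sigma>(1) by blast
qed

lemma slope_diff: "p \<in> S - crit \<Longrightarrow> slope e differentiable (at p)"
  unfolding slope_def[abs_def] by (intro differentiable_add differentiable_mult differentiable_const v_diff)

lemma slope_C4: "Ck_on 4 (slope e) (S - crit)"
  unfolding slope_def[abs_def] by (intro Ck_on_add Ck_on_mult Ck_on_const v_C4_off_crit open_off_crit)

lemma slope_cont: "continuous_on S (slope e)"
  unfolding slope_def[abs_def] by (intro continuous_intros v_cont)

lemma dir_slope:
  assumes p: "p \<in> S - crit"
  shows "dir a (slope e) p = (\<Sum>i\<in>UNIV. a $ i * (e $ 1 * hess 1 i p + e $ 2 * hess 2 i p))"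
  unfolding dir_def slope_def[abs_def] using v_diff[OF p] by (simp add: partial_add partial_mult hess_def)

lemma dir_slope_pos:
  obtains \<sigma> :: real where "\<sigma> = 1 \<or> \<sigma> = -1"
    "\<And>p (e :: real^2). p \<in> S - crit \<Longrightarrow> p \<noteq> 0 \<Longrightarrow> e \<noteq> 0 \<Longrightarrow> 0 < \<sigma> * dir e (slope e) p"
proof -
  obtain \<sigma> :: real where \<sigma>: "\<sigma> = 1 \<or> \<sigma> = -1"
    "\<And>p (e :: real^2). p \<in> S - crit \<Longrightarrow> p \<noteq> 0 \<Longrightarrow> e \<noteq> 0 \<Longrightarrow>
      0 < \<sigma> * ((e $ 1)\<^sup>2 * hess 1 1 p + 2 * e $ 1 * e $ 2 * hess 1 2 p + (e $ 2)\<^sup>2 * hess 2 2 p)"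
    using hess_definite by metis
  have "dir e (slope e) p = (e $ 1)\<^sup>2 * hess 1 1 p + 2 * e $ 1 * e $ 2 * hess 1 2 p + (e $ 2)\<^sup>2 * hess 2 2 p"
    if "p \<in> S - crit" for p e
    unfolding dir_slope[OF that] using hess_sym[OF that, of 2 1] by (simp add: sum_2 power2_eq_square algebra_simps)
  with \<sigma> show thesis by (intro that[of \<sigma>]) auto
qed

text \<open>Monotonicity of the gradient, even along lines that pass through critical points.\<close>

lemma slope_monotone:
  assumes \<sigma>: "\<And>p. p \<in> S - crit \<Longrightarrow> p \<noteq> 0 \<Longrightarrow> 0 < \<sigma> * dir e (slope e) p" and e: "e \<noteq> 0"
    and ab: "a \<le> b" and inS: "\<And>t. a \<le> t \<Longrightarrow> t \<le> b \<Longrightarrow> p + t *\<^sub>R e \<in> S"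
  shows "\<sigma> * slope e (p + a *\<^sub>R e) \<le> \<sigma> * slope e (p + b *\<^sub>R e)"
proof (rule nondecreasing_countable_exceptions[OF ab, of "\<lambda>t. \<sigma> * slope e (p + t *\<^sub>R e)"])
  let ?C = "{t. p + t *\<^sub>R e \<in> insert 0 crit}"
  show "continuous_on {a..b} (\<lambda>t. \<sigma> * slope e (p + t *\<^sub>R e))"
    by (intro continuous_on_mult continuous_on_const continuous_on_compose2[OF slope_cont])
      (use inS in \<open>auto intro!: continuous_intros\<close>)
  have "inj_on (\<lambda>t. p + t *\<^sub>R e) ?C" using e by (auto simp: inj_on_def)
  moreover have "countable ((\<lambda>t. p + t *\<^sub>R e) ` ?C)"
    by (rule countable_subset[of _ "insert 0 crit"]) (use countable_crit in auto)
  ultimately show "countable ?C" by (rule countable_image_inj_on[rotated])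
  fix t assume t: "a < t" "t < b" "t \<notin> ?C"
  then have pt: "p + t *\<^sub>R e \<in> S - crit" "p + t *\<^sub>R e \<noteq> 0" using inS[of t] by auto
  show "\<exists>l>0. ((\<lambda>t. \<sigma> * slope e (p + t *\<^sub>R e)) has_real_derivative l) (at t)"
    using \<sigma>[OF pt] DERIV_cmult[OF has_real_derivative_line[OF slope_diff[OF pt(1)]], of \<sigma>]
    unfolding dir_def by blast
qed

text \<open>
  On the segment from the origin to another critical point the monotone derivative of \<open>u\<close> along
  the segment vanishes at both ends, hence throughout, although its own derivative is nonzero at the
  noncritical points of the segment.
\<close>

lemma crit_eq: "crit = {0}"
proof -
  obtain \<sigma> :: real where \<sigma>: "\<sigma> = 1 \<or> \<sigma> = -1"
    "\<And>p (e :: real^2). p \<in> S - crit \<Longrightarrow> p \<noteq> 0 \<Longrightarrow> e \<noteq> 0 \<Longrightarrow> 0 < \<sigma> * dir e (slope e) p"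
    using dir_slope_pos by metis
  have "z = 0" if z: "z \<in> crit" for z
  proof (rule ccontr)
    assume nz: "z \<noteq> 0"
    have zS: "norm z < r" using z crit_sub by auto
    have inS: "0 + t *\<^sub>R z \<in> S" if "0 \<le> t" "t \<le> 1" for t
      using that zS mult_left_le_one_le[of "norm z" t] by simp
    let ?\<phi> = "\<lambda>t. \<sigma> * slope z (0 + t *\<^sub>R z)"
    have end0: "?\<phi> 0 = 0" "?\<phi> 1 = 0" using z v_zero by (auto simp: slope_def crit_def)
    have mono: "?\<phi> s \<le> ?\<phi> t" if "0 \<le> s" "s \<le> t" "t \<le> 1" for s t
      by (rule slope_monotone) (use that nz \<sigma>(2) inS in auto)
    have \<phi>0: "?\<phi> t = 0" if "0 \<le> t" "t \<le> 1" for t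
      using mono[OF order_refl that] mono[OF that order_refl] unfolding end0 by linarith
    obtain d where d: "d > 0" "\<forall>y\<in>crit. norm (y - z) < d \<longrightarrow> y = z" using crit_isolated[OF z nz] by blast
    define h where "h = min (1 / 2) (d / (2 * norm z))"
    have h: "0 < h" "h \<le> 1 / 2" "h * norm z < d"
    proof -
      show "0 < h" "h \<le> 1 / 2" using d nz by (auto simp: h_def)
      have "h * norm z \<le> d / (2 * norm z) * norm z" by (intro mult_right_mono) (auto simp: h_def)
      then show "h * norm z < d" using d nz by simp
    qed
    define t where "t = 1 - h"
    have t: "0 < t" "t < 1" using h by (auto simp: t_def)
    have "t *\<^sub>R z - z = - (h *\<^sub>R z)" by (simp add: t_def algebra_simps)
    then have "norm (t *\<^sub>R z - z) < d" using h by simp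
    then have "t *\<^sub>R z \<notin> crit" using d(2) t nz by (metis less_irrefl scaleR_cancel_right scaleR_one)
    then have pt: "0 + t *\<^sub>R z \<in> S - crit" "0 + t *\<^sub>R z \<noteq> 0" using inS[of t] t nz by auto
    have "(?\<phi> has_real_derivative \<sigma> * dir z (slope z) (0 + t *\<^sub>R z)) (at t)"
      unfolding dir_def by (intro DERIV_cmult has_real_derivative_line slope_diff pt)
    moreover have "(?\<phi> has_real_derivative 0) (at t)"
      by (rule has_field_derivative_transform_within_open[OF DERIV_const[of 0], of "{0<..<1}"])
        (use t \<phi>0 in auto)
    ultimately have "\<sigma> * dir z (slope z) (0 + t *\<^sub>R z) = 0" using DERIV_unique by blast
    then show False using \<sigma>(2)[OF pt nz] by linarith
  qed
  moreover have "0 \<in> crit" using r_pos v_zero by (simp add: crit_def)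
  ultimately show ?thesis by blast
qed

end

section \<open>Bounded third derivatives\<close>

context positively_curved_graph
begin

lemma dir_dir_slope:
  assumes p: "p \<in> S - crit"
  shows "dir e (dir e (slope e)) p = (e $ 1) ^ 3 * third 1 1 1 p + 3 * (e $ 1)\<^sup>2 * e $ 2 * third 1 1 2 p
    + 3 * e $ 1 * (e $ 2)\<^sup>2 * third 1 2 2 p + (e $ 2) ^ 3 * third 2 2 2 p"
proof -
  have "dir e (dir e (slope e)) p =
      dir e (\<lambda>q. (e $ 1)\<^sup>2 * hess 1 1 q + (2 * e $ 1 * e $ 2 * hess 1 2 q + (e $ 2)\<^sup>2 * hess 2 2 q)) p"
  proof (rule dir_cong[OF open_off_crit p])
    fix q assume q: "q \<in> S - crit"
    show "dir e (slope e) q = (e $ 1)\<^sup>2 * hess 1 1 q + (2 * e $ 1 * e $ 2 * hess 1 2 q + (e $ 2)\<^sup>2 * hess 2 2 q)"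
      unfolding dir_slope[OF q] using hess_sym[OF q, of 2 1] by (simp add: sum_2 power2_eq_square algebra_simps)
  qed
  also have "\<dots> = (\<Sum>i\<in>UNIV. e $ i * ((e $ 1)\<^sup>2 * third 1 1 i p + (2 * e $ 1 * e $ 2 * third 1 2 i p + (e $ 2)\<^sup>2 * third 2 2 i p)))"
    unfolding dir_def using hess_diff[OF p]
    by (simp add: partial_add partial_mult differentiable_add differentiable_mult third_def)
  finally show ?thesis
    using third_sym23[OF p, of 1 2 1] third_sym23[OF p, of 2 2 1] third_sym12[OF p, of 2 1 2]
    by (simp add: sum_2 power2_eq_square power3_eq_cube algebra_simps)
qed

lemma dir_dir_slope_C2: "Ck_on 2 (dir e (dir e (slope e))) (S - crit)"
proof -
  have "(4::nat) = Suc (Suc 2)" by simp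
  then have "Ck_on (Suc (Suc 2)) (slope e) (S - crit)" using slope_C4[of e] by (simp only:)
  then show ?thesis by (intro Ck_on_dir open_off_crit)
qed

text \<open>
  Along a line in direction \<open>e\<close> the derivative \<open>slope = \<partial>\<^sub>e u\<close> is monotone and its square is
  \<open>g(e, e) - \<bar>e\<bar>\<^sup>2\<close>, which is \<open>C\<^sup>4\<close>; the bound for monotone roots therefore controls
  \<open>\<partial>\<^sub>e\<^sup>3 u\<close> uniformly, however close the line passes to the critical point.
\<close>

lemma dir_dir_slope_bounded:
  assumes e: "e \<noteq> 0" and \<rho>: "\<rho> < r"
  shows "\<exists>B. \<forall>p\<in>ball 0 \<rho> - {0}. \<bar>dir e (dir e (slope e)) p\<bar> \<le> B"
proof -
  obtain \<sigma> :: real where \<sigma>: "\<sigma> = 1 \<or> \<sigma> = -1"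
    "\<And>p (e :: real^2). p \<in> S - crit \<Longrightarrow> p \<noteq> 0 \<Longrightarrow> e \<noteq> 0 \<Longrightarrow> 0 < \<sigma> * dir e (slope e) p"
    using dir_slope_pos by metis
  have \<sigma>2: "\<sigma> * \<sigma> = 1" using \<sigma>(1) by auto
  define s where "s = (r - \<rho>) / (2 * norm e)"
  have s: "s > 0" using e \<rho> by (simp add: s_def)
  define C where "C = cball (0::real^2) ((\<rho> + r) / 2)"
  have C: "compact C" "C \<subseteq> S" using \<rho> by (auto simp: C_def)
  have inC: "p + t *\<^sub>R e \<in> C" if "p \<in> ball 0 \<rho>" "\<bar>t\<bar> \<le> s" for p t
  proof -
    have "\<bar>t\<bar> * norm e \<le> s * norm e" using that by (intro mult_right_mono) auto
    then have "norm (t *\<^sub>R e) \<le> (r - \<rho>) / 2" using e by (simp add: s_def)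
    then show ?thesis using that norm_triangle_ineq[of p "t *\<^sub>R e"] by (simp add: C_def field_simps)
  qed
  define f where "f q = e \<bullet> (g q *v e) + - (e \<bullet> e)" for q
  have f_C4: "Ck_on 4 f S"
    unfolding f_def by (intro Ck_on_add Ck_on_const Ck_on_bounded_linear[OF _ bounded_linear_quadratic g_C4]) auto
  have f_sq: "f q = slope e q * slope e q" if "q \<in> S" for q
    using g_quadratic[OF that, of e] by (simp add: f_def power2_eq_square)
  let ?D = "\<lambda>n. (dir e ^^ n) f"
  have D_C: "Ck_on (4 - n) (?D n) S" if "n \<le> 4" for n
    by (rule Ck_on_dir_iterate) (use that f_C4 in auto)
  have "\<exists>A. \<forall>q\<in>C. \<bar>?D n q\<bar> \<le> A" if "n \<le> 4" for n
  proof -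
    have "continuous_on C (?D n)"
      using continuous_on_subset[OF Ck_on_continuous[OF D_C[OF that]] C(2)] .
    then have "bounded (?D n ` C)" by (intro compact_imp_bounded compact_continuous_image C(1))
    then show ?thesis unfolding bounded_iff by auto
  qed
  then obtain A' where A': "\<And>n q. n \<le> 4 \<Longrightarrow> q \<in> C \<Longrightarrow> \<bar>?D n q\<bar> \<le> A' n" by metis
  define A where "A = Max (A' ` {..4})"
  have A: "\<bar>?D n q\<bar> \<le> A" if "n \<le> 4" "q \<in> C" for n q
    using A'[OF that] Max_ge[of "A' ` {..4}" "A' n"] that by (auto simp: A_def intro: order_trans)
  let ?X = "dir e (dir e (slope e))"
  have S0: "S - crit = S - {0}" by (simp add: crit_eq)
  have away: "\<bar>?X p\<bar> \<le> root_const A s" if p: "p \<in> ball 0 \<rho> - {0}" and nz: "slope e p \<noteq> 0" for p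
  proof -
    have pS: "p \<in> S - crit" using p \<rho> by (auto simp: S0)
    have "\<bar>\<sigma> * ?X p\<bar> \<le> root_const A s"
    proof (rule monotone_root_second_derivative_bound[OF s,
          where F = "\<lambda>n t. ?D n (p + t *\<^sub>R e)" and \<phi> = "\<lambda>t. \<sigma> * slope e (p + t *\<^sub>R e)" and m = "\<sigma> * dir e (slope e) p"])
      fix n t assume n: "n < (4::nat)" and t: "\<bar>t\<bar> \<le> s"
      have n4: "4 - n = Suc (3 - n)" using n by arith
      have "Ck_on (Suc (3 - n)) (?D n) S" using D_C[OF less_imp_le[OF n]] unfolding n4 .
      then have "?D n differentiable (at (p + t *\<^sub>R e))" using inC[OF _ t] p C(2) by auto
      from has_real_derivative_line[OF this]
      show "((\<lambda>t. ?D n (p + t *\<^sub>R e)) has_real_derivative ?D (Suc n) (p + t *\<^sub>R e)) (at t)"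
        by (simp add: dir_def)
    next
      fix n t assume "n \<le> (4::nat)" "\<bar>t\<bar> \<le> s"
      then show "\<bar>?D n (p + t *\<^sub>R e)\<bar> \<le> A" using A inC p by simp
    next
      fix t assume "\<bar>t\<bar> \<le> s"
      then have "p + t *\<^sub>R e \<in> S" using inC[of p t] p C(2) by blast
      then show "?D 0 (p + t *\<^sub>R e) = (\<sigma> * slope e (p + t *\<^sub>R e))\<^sup>2"
        using f_sq \<sigma>(1) by (auto simp: power2_eq_square)
    next
      have "p + t *\<^sub>R e \<in> S" if "t \<in> {-s..s}" for t
      proof -
        have "\<bar>t\<bar> \<le> s" using that by auto
        then show ?thesis using inC[of p t] p C(2) by blast
      qed
      then show "continuous_on {-s..s} (\<lambda>t. \<sigma> * slope e (p + t *\<^sub>R e))"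
        by (intro continuous_on_mult continuous_on_const continuous_on_compose2[OF slope_cont])
          (auto intro!: continuous_intros)
      show "mono_on {-s..s} (\<lambda>t. \<sigma> * slope e (p + t *\<^sub>R e))"
      proof (rule mono_onI)
        fix a b assume ab: "a \<in> {-s..s}" "b \<in> {-s..s}" "a \<le> b"
        show "\<sigma> * slope e (p + a *\<^sub>R e) \<le> \<sigma> * slope e (p + b *\<^sub>R e)"
        proof (rule slope_monotone)
          show "p + t *\<^sub>R e \<in> S" if "a \<le> t" "t \<le> b" for t
          proof -
            have "\<bar>t\<bar> \<le> s" using that ab by auto
            then show ?thesis using inC[of p t] p C(2) by blast
          qed
        qed (use \<sigma>(2) e ab in auto)
      qed
    next
      show "\<sigma> * slope e (p + 0 *\<^sub>R e) \<noteq> 0" using nz \<sigma>(1) by auto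
      have d1: "dir e f q = 2 * (slope e q * dir e (slope e) q)" if q: "q \<in> S - crit" for q
      proof -
        have "dir e f q = dir e (\<lambda>q. slope e q * slope e q) q"
          by (rule dir_cong[OF open_off_crit q]) (simp add: f_sq)
        then show ?thesis by (simp add: dir_mult[OF slope_diff[OF q] slope_diff[OF q]])
      qed
      show "?D 1 (p + 0 *\<^sub>R e) = 2 * (\<sigma> * slope e (p + 0 *\<^sub>R e)) * (\<sigma> * dir e (slope e) p)"
        using d1[OF pS] \<sigma>(1) by auto
      have dw: "dir e (slope e) differentiable (at p)"
      proof -
        have "(4::nat) = Suc (Suc 2)" by simp
        then have "Ck_on (Suc (Suc 2)) (slope e) (S - crit)" using slope_C4[of e] by (simp only:)
        then have "Ck_on (Suc 2) (dir e (slope e)) (S - crit)" by (intro Ck_on_dir open_off_crit)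
        then show ?thesis using pS unfolding Ck_on.simps(2) by blast
      qed
      have "dir e (dir e f) p = dir e (\<lambda>q. slope e q * dir e (slope e) q + slope e q * dir e (slope e) q) p"
        by (rule dir_cong[OF open_off_crit pS]) (simp add: d1)
      also have "\<dots> = 2 * (dir e (slope e) p)\<^sup>2 + 2 * slope e p * ?X p"
        unfolding dir_add[OF differentiable_mult[OF slope_diff[OF pS] dw] differentiable_mult[OF slope_diff[OF pS] dw]]
          dir_mult[OF slope_diff[OF pS] dw]
        by (simp add: power2_eq_square)
      finally show "?D 2 (p + 0 *\<^sub>R e) = 2 * (\<sigma> * dir e (slope e) p)\<^sup>2 + 2 * (\<sigma> * slope e (p + 0 *\<^sub>R e)) * (\<sigma> * ?X p)"
        using \<sigma>(1) by (auto simp: numeral_2_eq_2)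
    qed
    then show ?thesis using \<sigma>(1) by (auto simp: abs_mult)
  qed
  have "\<bar>?X p\<bar> \<le> root_const A s" if p: "p \<in> ball 0 \<rho> - {0}" for p
  proof (rule ccontr)
    \<comment> \<open>A zero of \<open>slope\<close> is simple along the line, so the bound passes to it by continuity.\<close>
    assume big: "\<not> \<bar>?X p\<bar> \<le> root_const A s"
    have pS: "p \<in> S - crit" using p \<rho> by (auto simp: S0)
    have w0: "slope e p = 0" using away[OF p] big by blast
    let ?O = "ball 0 \<rho> - {0} :: (real^2) set"
    have "continuous_on ?O (\<lambda>q. \<bar>?X q\<bar>)"
      by (intro continuous_on_rabs continuous_on_subset[OF Ck_on_continuous[OF dir_dir_slope_C2]])
        (use \<rho> in \<open>auto simp: S0\<close>)
    then have "open (?O \<inter> (\<lambda>q. \<bar>?X q\<bar>) -` {root_const A s<..})"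
      by (rule continuous_open_preimage) (auto intro: open_Diff)
    then obtain d where d: "d > 0" "ball p d \<subseteq> ?O \<inter> (\<lambda>q. \<bar>?X q\<bar>) -` {root_const A s<..}"
      using p big open_contains_ball by (metis (no_types, lifting) IntI greaterThan_iff not_le vimageI)
    have "((\<lambda>t. \<sigma> * slope e (p + t *\<^sub>R e)) has_real_derivative \<sigma> * dir e (slope e) p) (at 0)"
      using DERIV_cmult[OF has_real_derivative_line[of "slope e" p 0 e], of \<sigma>] slope_diff[OF pS, of e]
      by (simp add: dir_def)
    from has_real_derivative_pos_inc_right[OF this \<sigma>(2)[OF pS _ e]] p w0
    obtain d' where d': "d' > 0" "\<And>h. h > 0 \<Longrightarrow> h < d' \<Longrightarrow> 0 < \<sigma> * slope e (p + h *\<^sub>R e)" by auto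
    define h where "h = min (d' / 2) (d / (2 * norm e))"
    have h: "h > 0" "h < d'" using d d' e by (auto simp: h_def)
    have "h * norm e \<le> d / (2 * norm e) * norm e" by (intro mult_right_mono) (auto simp: h_def)
    then have "h * norm e < d" using e d by simp
    then have "p + h *\<^sub>R e \<in> ball p d" using h by (simp add: dist_norm)
    then have "p + h *\<^sub>R e \<in> ?O \<inter> (\<lambda>q. \<bar>?X q\<bar>) -` {root_const A s<..}"
      by (rule subsetD[OF d(2)])
    then have "p + h *\<^sub>R e \<in> ?O" "root_const A s < \<bar>?X (p + h *\<^sub>R e)\<bar>" by simp_all
    moreover have "slope e (p + h *\<^sub>R e) \<noteq> 0" using d'(2)[OF h] by auto
    ultimately show False using away[of "p + h *\<^sub>R e"] by linarith
  qed
  then show ?thesis by blast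
qed

text \<open>A symmetric cubic form is determined by its values in four directions.\<close>

lemma third_bounded:
  assumes \<rho>: "\<rho> < r"
  shows "\<exists>B. \<forall>p\<in>ball 0 \<rho> - {0}. \<forall>i j k. \<bar>third i j k p\<bar> \<le> B"
proof -
  let ?Q = "\<lambda>a b p. a ^ 3 * third 1 1 1 p + 3 * a\<^sup>2 * b * third 1 1 2 p + 3 * a * b\<^sup>2 * third 1 2 2 p + b ^ 3 * third 2 2 2 p"
  have bd: "\<exists>B. \<forall>p\<in>ball 0 \<rho> - {0}. \<bar>?Q a b p\<bar> \<le> B" if ab: "a \<noteq> 0 \<or> b \<noteq> 0" for a b :: real
  proof -
    define e :: "real^2" where "e = vector [a, b]"
    have "e \<noteq> 0" using ab by (auto simp: e_def vec_eq_iff forall_2)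
    then obtain B where B: "\<forall>p\<in>ball 0 \<rho> - {0}. \<bar>dir e (dir e (slope e)) p\<bar> \<le> B"
      using dir_dir_slope_bounded[OF _ \<rho>] by blast
    have "dir e (dir e (slope e)) p = ?Q a b p" if "p \<in> ball 0 \<rho> - {0}" for p
      using dir_dir_slope[of p e] that \<rho> by (simp add: crit_eq e_def)
    then have "\<forall>p\<in>ball 0 \<rho> - {0}. \<bar>?Q a b p\<bar> \<le> B" using B by (metis (no_types, lifting))
    then show ?thesis by blast
  qed
  have "\<exists>B. \<forall>p\<in>ball 0 \<rho> - {0}. \<bar>?Q 1 0 p\<bar> \<le> B" by (rule bd) simp
  then obtain B1 where B1: "\<forall>p\<in>ball 0 \<rho> - {0}. \<bar>?Q 1 0 p\<bar> \<le> B1" ..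
  have "\<exists>B. \<forall>p\<in>ball 0 \<rho> - {0}. \<bar>?Q 0 1 p\<bar> \<le> B" by (rule bd) simp
  then obtain B2 where B2: "\<forall>p\<in>ball 0 \<rho> - {0}. \<bar>?Q 0 1 p\<bar> \<le> B2" ..
  have "\<exists>B. \<forall>p\<in>ball 0 \<rho> - {0}. \<bar>?Q 1 1 p\<bar> \<le> B" by (rule bd) simp
  then obtain B3 where B3: "\<forall>p\<in>ball 0 \<rho> - {0}. \<bar>?Q 1 1 p\<bar> \<le> B3" ..
  have "\<exists>B. \<forall>p\<in>ball 0 \<rho> - {0}. \<bar>?Q 1 (-1) p\<bar> \<le> B" by (rule bd) simp
  then obtain B4 where B4: "\<forall>p\<in>ball 0 \<rho> - {0}. \<bar>?Q 1 (-1) p\<bar> \<le> B4" ..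
  have "\<bar>third i j k p\<bar> \<le> B1 + B2 + B3 + B4" if p: "p \<in> ball 0 \<rho> - {0}" for p i j k
  proof -
    have pS: "p \<in> S - crit" using p \<rho> by (auto simp: crit_eq)
    define x y z t where "x = third 1 1 1 p" and "y = third 1 1 2 p" and "z = third 1 2 2 p" and "t = third 2 2 2 p"
    have "\<bar>x\<bar> \<le> B1" "\<bar>t\<bar> \<le> B2" "\<bar>x + 3 * y + 3 * z + t\<bar> \<le> B3" "\<bar>x - 3 * y + 3 * z - t\<bar> \<le> B4"
      using bspec[OF B1 p] bspec[OF B2 p] bspec[OF B3 p] bspec[OF B4 p] by (simp_all add: x_def y_def z_def t_def)
    then have "\<bar>x\<bar> \<le> B1 + B2 + B3 + B4" "\<bar>y\<bar> \<le> B1 + B2 + B3 + B4" "\<bar>z\<bar> \<le> B1 + B2 + B3 + B4"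
      "\<bar>t\<bar> \<le> B1 + B2 + B3 + B4" by (auto simp: abs_le_iff)
    moreover have "third i j k p \<in> {x, y, z, t}"
      using exhaust_2[of i] exhaust_2[of j] exhaust_2[of k]
        third_sym12[OF pS, of 2 1] third_sym23[OF pS, of 1 2 1] third_sym23[OF pS, of 2 2 1]
      by (auto simp: x_def y_def z_def t_def)
    ultimately show ?thesis by auto
  qed
  then show ?thesis by blast
qed

lemma v_C11: "Ck1_on 1 (v i) S"
proof (rule Ck1_on_remove_point[OF r_pos v_cont])
  show "Ck_on 2 (v i) (S - {0})" using Ck_on_le[OF v_C4_off_crit, of 2 i] by (simp add: crit_eq)
  show "\<exists>B. \<forall>p\<in>ball 0 \<rho> - {0}. \<forall>i' j. \<bar>partial j (partial i' (v i)) p\<bar> \<le> B" if "\<rho> < r" for \<rho>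
    using third_bounded[OF that] unfolding third_def hess_def by blast
qed

end

section \<open>The regularity theorem\<close>

lemma Ck1_on_cong:
  assumes "open A" "\<And>p. p \<in> A \<Longrightarrow> f p = h p" "Ck1_on k f A"
  shows "Ck1_on k h A"
  using assms(2,3)
proof (induction k arbitrary: f h)
  case 0
  then have "L-lipschitz_on K f \<longleftrightarrow> L-lipschitz_on K h" if "K \<subseteq> A" for L K
    using that by (intro lipschitz_on_cong) auto
  with 0 show ?case by simp
next
  case (Suc k)
  have "h differentiable (at p)" if "p \<in> A" for p
    using differentiable_cong_open[OF assms(1) that, of f h] Suc.prems that by auto
  moreover have "Ck1_on k (partial i h) A" for i
    by (rule Suc.IH[of "partial i f"]) (use Suc.prems partial_cong[OF assms(1), of _ f h] in auto)
  ultimately show ?case by simp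
qed

lemma Ck1_on_bounded_linear:
  assumes "open A" "bounded_linear L" "Ck1_on k f A"
  shows "Ck1_on k (\<lambda>q. c + L (f q)) A"
  using assms(3)
proof (induction k arbitrary: f c)
  case 0
  obtain B where B: "B \<ge> 0" "\<And>x. norm (L x) \<le> norm x * B"
    using bounded_linear.nonneg_bounded[OF assms(2)] by blast
  have "\<exists>M. M-lipschitz_on K (\<lambda>q. c + L (f q))" if K: "compact K" "K \<subseteq> A" for K
  proof -
    obtain M where M: "M-lipschitz_on K f" using 0 K by auto
    have "(M * B)-lipschitz_on K (\<lambda>q. c + L (f q))"
    proof (rule lipschitz_onI)
      fix x y assume xy: "x \<in> K" "y \<in> K"
      have "dist (c + L (f x)) (c + L (f y)) = norm (L (f x - f y))"
        by (simp add: dist_norm linear_diff[OF bounded_linear.linear[OF assms(2)]])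
      also have "\<dots> \<le> dist (f x) (f y) * B" using B(2) by (simp add: dist_norm)
      also have "\<dots> \<le> M * dist x y * B" by (intro mult_right_mono lipschitz_onD[OF M] xy B)
      finally show "dist (c + L (f x)) (c + L (f y)) \<le> M * B * dist x y" by (simp add: mult_ac)
    qed (use B lipschitz_on_nonneg[OF M] in simp)
    then show ?thesis by blast
  qed
  then show ?case by simp
next
  case (Suc k)
  have d: "(\<lambda>q. c + L (f q)) differentiable (at p)" if "p \<in> A" for p
    using Suc.prems that by (intro differentiable_add differentiable_const differentiable_bounded_linear[OF assms(2)]) auto
  have "Ck1_on k (partial i (\<lambda>q. c + L (f q))) A" for i
  proof (rule Ck1_on_cong[OF assms(1) _ Suc.IH[of "partial i f" 0]])
    fix p assume p: "p \<in> A"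
    then have "f differentiable (at p)" using Suc.prems by auto
    then show "0 + L (partial i f p) = partial i (\<lambda>q. c + L (f q)) p"
      by (simp add: partial_add differentiable_bounded_linear[OF assms(2)] partial_bounded_linear[OF assms(2)])
  qed (use Suc.prems in auto)
  then show ?case using d by simp
qed

lemma Ck1_on_0_continuous:
  assumes A: "open A" and f: "Ck1_on 0 f A"
  shows "continuous_on A f"
proof (rule continuous_at_imp_continuous_on, rule ballI)
  fix p assume "p \<in> A"
  then obtain e where e: "e > 0" "cball p e \<subseteq> A" using A open_contains_cball by blast
  then obtain L where "L-lipschitz_on (cball p e) f"
    using f[unfolded Ck1_on.simps(1), rule_format, of "cball p e"] compact_cball by blast
  then have "continuous_on (cball p e) f" by (rule lipschitz_on_continuous_on)
  then show "isCont f p" by (rule continuous_on_interior) (use e in auto)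
qed

theorem theorem1p1:
  fixes r :: real
    and g :: "real^2 \<Rightarrow> real^2^2"
    and u :: "real^2 \<Rightarrow> real"
    and X :: "real^2 \<Rightarrow> real^3"
  assumes "r > 0"
    and "Ck_riemannian_metric_on 4 g (ball 0 r)"
    and "\<And>p. p \<in> ball 0 r - {0} \<Longrightarrow> gauss_curvature g p > 0"
    and "Ck1_embedding_on 1 X (ball 0 r)"
    and "isometric_on g X (ball 0 r)"
    and "\<And>p. p \<in> ball 0 r \<Longrightarrow> X p = vector [p $ 1, p $ 2, u p]"
    and "u 0 = 0"
    and "partial 1 u 0 = 0"
    and "partial 2 u 0 = 0"
  shows "Ck1_on 2 X (ball 0 r)"
proof -
  let ?S = "ball (0::real^2) r"
  have X1: "Ck1_on 1 X ?S" using assms(4) by (simp add: Ck1_embedding_on_def)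
  then have X_diff: "X differentiable (at p)" if "p \<in> ?S" for p using that by simp
  have dX: "partial i X p = vector [kron i 1, kron i 2, partial i u p]" if p: "p \<in> ?S" for i p
  proof -
    have c: "partial i X p $ k = partial i (\<lambda>q. X q $ k) p" for k
      by (rule partial_bounded_linear[OF bounded_linear_vec_nth X_diff[OF p], symmetric])
    have pr: "partial i (\<lambda>q. q $ k) p = kron i k" for k :: 2
      by (subst partial_eq[OF bounded_linear_imp_has_derivative[OF bounded_linear_vec_nth]])
        (auto simp: axis_def kron_def)
    have "partial i (\<lambda>q. X q $ 1) p = kron i 1"
      unfolding pr[symmetric] by (rule partial_cong[OF open_ball p]) (simp add: assms(6))
    moreover have "partial i (\<lambda>q. X q $ 2) p = kron i 2"
      unfolding pr[symmetric] by (rule partial_cong[OF open_ball p]) (simp add: assms(6))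
    moreover have "partial i (\<lambda>q. X q $ 3) p = partial i u p"
      by (rule partial_cong[OF open_ball p]) (simp add: assms(6))
    ultimately show ?thesis by (simp add: vec_eq_iff forall_3 c)
  qed
  have u_diff: "u differentiable (at p)" if p: "p \<in> ?S" for p
    by (rule differentiable_cong_open[OF open_ball p, of "\<lambda>q. X q $ 3"])
      (auto simp: assms(6) intro!: differentiable_bounded_linear[OF bounded_linear_vec_nth] X_diff p[simplified])
  have g_eq: "g p $ i $ j = kron i j + partial i u p * partial j u p" if p: "p \<in> ?S" for p i j
  proof -
    have "g p $ i $ j = axis i 1 \<bullet> (g p *v axis j 1)"
      by (simp add: inner_axis' matrix_vector_mult_basis column_def)
    also have "\<dots> = partial i X p \<bullet> partial j X p"
      using assms(5) p by (simp add: isometric_on_def partial_def)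
    also have "\<dots> = kron i j + partial i u p * partial j u p"
      unfolding dX[OF p] using exhaust_2[of i] exhaust_2[of j]
      by (auto simp: inner_vec_def sum_3 kron_def)
    finally show ?thesis .
  qed
  have v_cont: "continuous_on ?S (partial i u)" for i
  proof -
    have "continuous_on ?S (partial i X)" using X1 by (intro Ck1_on_0_continuous) auto
    then have "continuous_on ?S (\<lambda>p. partial i X p $ 3)" by (intro continuous_intros)
    then show ?thesis by (rule continuous_on_eq) (simp add: dX)
  qed
  interpret positively_curved_graph r g u "\<lambda>i. partial i u"
  proof
    show "Ck_on 4 g ?S" using assms(2) by (simp add: Ck_riemannian_metric_on_def)
    show "partial i u 0 = 0" for i using assms(8,9) exhaust_2[of i] by auto
  qed (use assms(1,3) g_eq v_cont u_diff in auto)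
  have "Ck1_on 1 (partial i X) ?S" for i
  proof (rule Ck1_on_cong[OF open_ball _ Ck1_on_bounded_linear[OF open_ball _ v_C11[of i]]])
    show "bounded_linear (\<lambda>t. t *\<^sub>R (axis 3 1 :: real^3))" by (rule bounded_linear_scaleR_left)
    show "vector [kron i 1, kron i 2, 0] + partial i u p *\<^sub>R axis 3 1 = partial i X p"
      if "p \<in> ?S" for p
      using dX[OF that, of i] by (simp add: vec_eq_iff forall_3 axis_def)
  qed
  then show ?thesis using X_diff by (simp add: numeral_2_eq_2)
qed

end
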